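(* There is an absolute constant $C>0$ such that the following holds. Let $\mathcal{C}:\{\pm1\}^n\times\{\pm1\}^n\to\{\pm1\}$ be a deterministic two-party communication protocol with total communication at most $d$ bits, and let $h$ be its XOR-fiber. Then for every $\rho\in[-1,1]$, $$\Bigl|\mathbb{E}_{\mathbf{z}\sim\nu_\rho}[h(\mathbf{z})]-\mathbb{E}_{\mathbf{z}\sim\nu_0}[h(\mathbf{z})]\Bigr|\le C\,|\rho|\sqrt d .$$
   Context: For $\rho\in[-1,1]$, $\nu_\rho$ denotes the product distribution on $\{\pm1\}^n$ in which each coordinate independently has expectation $\rho$ (so $\nu_0$ is uniform). For $x,y\in\{\pm1\}^n$, $x\odot y$ is the entrywise product. The XOR-fiber of $\mathcal{C}$ is $h(z)=\mathbb{E}[\mathcal{C}(\mathbf{x},\mathbf{y})\mid \mathbf{x}\odot\mathbf{y}=z]$ with $\mathbf{x},\mathbf{y}$ independent uniform on $\{\pm1\}^n$. *)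

theory Defs
  imports Complex_Main
begin

definition cube :: "nat \<Rightarrow> int list set" where
  "cube n = {xs. length xs = n \<and> set xs \<subseteq> {-1, 1}}"

definition odot :: "int list \<Rightarrow> int list \<Rightarrow> int list" where
  "odot x y = map2 (*) x y"

text \<open>Deterministic two-party protocol trees: at an Alice node, Alice sends the bit
  f x (x her input) and the protocol continues in the corresponding subtree;
  likewise for Bob with his input y. Leaves carry the output.\<close>
datatype proto =
    Leaf int
  | Alice "int list \<Rightarrow> bool" proto proto
  | Bob "int list \<Rightarrow> bool" proto proto

fun run :: "proto \<Rightarrow> int list \<Rightarrow> int list \<Rightarrow> int" where
  "run (Leaf b) x y = b"
| "run (Alice f p q) x y = (if f x then run p x y else run q x y)"
| "run (Bob g p q) x y = (if g y then run p x y else run q x y)"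

fun comm :: "proto \<Rightarrow> nat" where
  "comm (Leaf b) = 0"
| "comm (Alice f p q) = Suc (max (comm p) (comm q))"
| "comm (Bob g p q) = Suc (max (comm p) (comm q))"

fun pm1_outputs :: "proto \<Rightarrow> bool" where
  "pm1_outputs (Leaf b) = (b \<in> {-1, 1})"
| "pm1_outputs (Alice f p q) = (pm1_outputs p \<and> pm1_outputs q)"
| "pm1_outputs (Bob g p q) = (pm1_outputs p \<and> pm1_outputs q)"

text \<open>XOR-fiber: conditional expectation of C(x,y) given x \<odot> y = z, x,y uniform on the cube.\<close>
definition xor_fiber :: "nat \<Rightarrow> (int list \<Rightarrow> int list \<Rightarrow> int) \<Rightarrow> int list \<Rightarrow> real" where
  "xor_fiber n C z =
     (\<Sum>(x,y)\<in>{(x,y). x \<in> cube n \<and> y \<in> cube n \<and> odot x y = z}. real_of_int (C x y))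
     / real (card {(x,y). x \<in> cube n \<and> y \<in> cube n \<and> odot x y = z})"

text \<open>Product measure nu_rho: each coordinate independently has mean rho.\<close>
definition nu :: "real \<Rightarrow> int list \<Rightarrow> real" where
  "nu \<rho> z = (\<Prod>i<length z. (1 + \<rho> * real_of_int (z ! i)) / 2)"

definition expect_nu :: "nat \<Rightarrow> real \<Rightarrow> (int list \<Rightarrow> real) \<Rightarrow> real" where
  "expect_nu n \<rho> h = (\<Sum>z\<in>cube n. nu \<rho> z * h z)"

end

theory Submission
  imports Defs
begin

text \<open>
  Write \<open>g \<rho>\<close> for the expectation of the fiber under \<open>nu \<rho>\<close>. Reading \<open>nu \<rho>\<close> as a random restriction
  (each coordinate of \<open>x \<odot> y\<close> is fixed to the sign of \<open>\<rho>\<close> with probability \<open>\<bar>\<rho>\<bar>\<close>, the others stay uniform)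
  bounds \<open>(1 - \<bar>\<rho>\<bar>) \<bar>g' \<rho>\<bar>\<close> by the correlation of a \<open>d\<close>-bit protocol with the inner product of the free
  coordinates, for inputs uniform on a product of two subcubes. That correlation is at most
  \<open>sqrt (2 d)\<close>, and the mean value theorem finishes the argument.

  For the correlation bound, consider on a rectangle \<open>A \<times> B\<close> the potential
  \<open>\<Sum>i. E Var (x\<^sub>i | x\<^sub>j, j < i) * E Var (y\<^sub>i | y\<^sub>j, j > i)\<close>. It starts at the number of free coordinates and
  one bit of communication lowers its average by at most 2. The two opposite orders make the products of
  innovations orthogonal in \<open>L\<^sup>2 (A \<times> B)\<close>, so by Bessel's inequality the squared mean of the inner
  product on a leaf is at most its second moment minus the potential of the leaf. Averaging over the
  leaves gives a mean square of at most \<open>2 d\<close>.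
\<close>

section \<open>Sums over the sign cube\<close>

lemma finite_cube [simp]: "finite (cube n)"
  unfolding cube_def by (rule finite_subset[OF _ finite_lists_length_eq[of "{-1,1::int}" n]]) auto

lemma cube_0 [simp]: "cube 0 = {[]}"
  by (auto simp: cube_def)

lemma cube_length: "x \<in> cube n \<Longrightarrow> length x = n"
  by (simp add: cube_def)

lemma cube_nth: "x \<in> cube n \<Longrightarrow> i < n \<Longrightarrow> x ! i = 1 \<or> x ! i = -1"
  unfolding cube_def using nth_mem[of i x] by blast

lemma take_cube: "x \<in> cube n \<Longrightarrow> i \<le> n \<Longrightarrow> take i x \<in> cube i"
  by (auto simp: cube_def dest: in_set_takeD)

lemma cube_snoc [simp]: "k @ [s] \<in> cube (Suc i) \<longleftrightarrow> k \<in> cube i \<and> (s = 1 \<or> s = -1)"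
  by (auto simp: cube_def)

lemma cube_Suc: "cube (Suc i) = (\<lambda>k. k @ [1]) ` cube i \<union> (\<lambda>k. k @ [-1]) ` cube i"
proof -
  have "x \<in> (\<lambda>k. k @ [1]) ` cube i \<union> (\<lambda>k. k @ [-1]) ` cube i" if "x \<in> cube (Suc i)" for x
    using that by (cases x rule: rev_cases) (auto simp: cube_def)
  then show ?thesis by auto
qed

lemma sum_cube_Suc:
  "sum F (cube (Suc i)) = (\<Sum>k\<in>cube i. F (k @ [1]) + (F (k @ [-1]) :: real))"
proof -
  have "sum F (cube (Suc i)) = sum F ((\<lambda>k. k @ [1]) ` cube i) + sum F ((\<lambda>k. k @ [-1]) ` cube i)"
    unfolding cube_Suc by (rule sum.union_disjoint) auto
  also have "\<dots> = (\<Sum>k\<in>cube i. F (k @ [1])) + (\<Sum>k\<in>cube i. F (k @ [-1]))"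
    by (simp add: sum.reindex inj_on_def)
  finally show ?thesis by (simp add: sum.distrib)
qed

lemma card_cube: "card (cube n) = 2 ^ n"
proof -
  have "real (card (cube n)) = 2 ^ n"
  proof (induction n)
    case (Suc n)
    have "real (card (cube (Suc n))) = (\<Sum>k\<in>cube (Suc n). 1)" by simp
    also have "\<dots> = 2 * real (card (cube n))" unfolding sum_cube_Suc by simp
    finally show ?case using Suc by simp
  qed simp
  then show ?thesis by (metis of_nat_eq_iff of_nat_numeral of_nat_power)
qed

section \<open>Masses of prefixes under a weight\<close>

text \<open>A weight \<open>f\<close> stands for an unnormalised density on the cube. Without
  normalisation every mass is additive when a message splits \<open>f\<close> into two
  parts.\<close>

definition prefix_mass :: "nat \<Rightarrow> (int list \<Rightarrow> real) \<Rightarrow> int list \<Rightarrow> real" where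
  "prefix_mass n f k = (\<Sum>x\<in>{x \<in> cube n. take (length k) x = k}. f x)"

definition mass :: "nat \<Rightarrow> (int list \<Rightarrow> real) \<Rightarrow> real" where
  "mass n f = (\<Sum>x\<in>cube n. f x)"

lemma prefix_mass_Nil [simp]: "prefix_mass n f [] = mass n f"
  by (simp add: prefix_mass_def mass_def)

lemma prefix_mass_nonneg: "(\<And>x. f x \<ge> 0) \<Longrightarrow> prefix_mass n f k \<ge> 0"
  by (simp add: prefix_mass_def sum_nonneg)

lemma mass_nonneg: "(\<And>x. f x \<ge> 0) \<Longrightarrow> mass n f \<ge> 0"
  by (simp add: mass_def sum_nonneg)

lemma prefix_mass_add:
  "prefix_mass n (\<lambda>x. f x + g x) k = prefix_mass n f k + prefix_mass n g k"
  by (simp add: prefix_mass_def sum.distrib)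

lemma mass_add: "mass n (\<lambda>x. f x + g x) = mass n f + mass n g"
  by (simp add: mass_def sum.distrib)

lemma sum_by_prefix:
  assumes "i \<le> n"
  shows "(\<Sum>x\<in>cube n. f x * G (take i x)) = (\<Sum>k\<in>cube i. prefix_mass n f k * G k)"
proof -
  have "(\<Sum>k\<in>cube i. prefix_mass n f k * G k)
      = (\<Sum>k\<in>cube i. \<Sum>x\<in>{x \<in> cube n. take i x = k}. f x * G (take i x))"
    by (rule sum.cong) (auto simp: prefix_mass_def sum_distrib_right cube_length)
  also have "\<dots> = (\<Sum>x\<in>cube n. f x * G (take i x))"
    by (rule sum.group) (auto intro: take_cube assms)
  finally show ?thesis by simp
qed

text \<open>Both \<open>take i x\<close> and \<open>x ! i\<close> are functions of the prefix of
  length \<open>Suc i\<close>, so this is \<open>sum_by_prefix\<close> one level further down, with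
  the last sign written out.\<close>

lemma sum_by_prefix_coord:
  assumes "i < n"
  shows "(\<Sum>x\<in>cube n. f x * G (take i x) (x ! i))
    = (\<Sum>k\<in>cube i. prefix_mass n f (k @ [1]) * G k 1 + prefix_mass n f (k @ [-1]) * G k (-1))"
proof -
  have "(\<Sum>x\<in>cube n. f x * G (take i x) (x ! i))
      = (\<Sum>x\<in>cube n. f x * G (butlast (take (Suc i) x)) (last (take (Suc i) x)))"
    using assms by (intro sum.cong refl) (simp add: take_Suc_conv_app_nth cube_length)
  also have "\<dots> = (\<Sum>k\<in>cube (Suc i). prefix_mass n f k * G (butlast k) (last k))"
    using assms by (intro sum_by_prefix) simp
  finally show ?thesis by (simp add: sum_cube_Suc)
qed

lemma prefix_mass_split:
  assumes "i < n" "k \<in> cube i"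
  shows "prefix_mass n f k = prefix_mass n f (k @ [1]) + prefix_mass n f (k @ [-1])"
proof -
  \<comment> \<open>The indicator of \<open>k\<close> turns the claim about one prefix into a sum
    over all prefixes.\<close>
  define \<delta> :: "int list \<Rightarrow> real" where "\<delta> l = (if l = k then 1 else 0)" for l
  have "prefix_mass n f k = (\<Sum>x\<in>cube n. if take i x = k then f x else 0)"
    using assms by (simp add: prefix_mass_def sum.inter_filter cube_length)
  also have "\<dots> = (\<Sum>x\<in>cube n. f x * \<delta> (take i x))"
    by (rule sum.cong) (auto simp: \<delta>_def)
  also have "\<dots> = (\<Sum>l\<in>cube i. prefix_mass n f (l @ [1]) * \<delta> l + prefix_mass n f (l @ [-1]) * \<delta> l)"
    using sum_by_prefix_coord[OF assms(1), of f "\<lambda>l _. \<delta> l"] .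
  also have "\<dots> = (\<Sum>l\<in>cube i. if l = k then prefix_mass n f (l @ [1]) + prefix_mass n f (l @ [-1]) else 0)"
    by (rule sum.cong) (auto simp: \<delta>_def)
  also have "\<dots> = prefix_mass n f (k @ [1]) + prefix_mass n f (k @ [-1])"
    using assms by simp
  finally show ?thesis .
qed

section \<open>Variance of a weighted sign\<close>

text \<open>For a sign with weight \<open>p\<close> on 1 and \<open>q\<close> on -1 this is its
  variance times the total weight \<open>p + q\<close>. On an empty part, division by zero gives
  0.\<close>

definition bit_var :: "real \<Rightarrow> real \<Rightarrow> real" where
  "bit_var p q = 4 * p * q / (p + q)"

lemma bit_var_le: "p \<ge> 0 \<Longrightarrow> q \<ge> 0 \<Longrightarrow> bit_var p q \<le> p + q"
proof (cases "p + q = 0")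
  case False
  assume "p \<ge> 0" "q \<ge> 0"
  with False have "p + q > 0" by simp
  have "4 * p * q \<le> (p + q) * (p + q)"
    using zero_le_square[of "p - q"] by (simp add: algebra_simps)
  with \<open>p + q > 0\<close> show ?thesis by (simp add: bit_var_def divide_le_eq)
qed (simp add: bit_var_def)

text \<open>Law of total variance for the merger of two parts: the right side is the mass-weighted
  variance between their means \<open>(a - b) / (a + b)\<close> and
  \<open>(c - d) / (c + d)\<close>.\<close>

lemma bit_var_split_eq:
  assumes "a + b > 0" "c + d > (0::real)"
  shows "bit_var (a + c) (b + d) - bit_var a b - bit_var c d
    = 4 * (a * d - b * c)\<^sup>2 / ((a + b) * (c + d) * (a + b + c + d))"
proof -
  define s t where "s = a + b" and "t = c + d"
  have *: "b = s - a" "d = t - c" "s > 0" "t > 0" "s + t > 0" using assms by (auto simp: s_def t_def)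
  have "bit_var (a + c) (b + d) - bit_var a b - bit_var c d =
     4 * (a + c) * (s + t - a - c) / (s + t) - 4 * a * (s - a) / s - 4 * c * (t - c) / t"
    unfolding bit_var_def * by (simp add: algebra_simps)
  also have "\<dots> = 4 * (a * t - s * c)\<^sup>2 / (s * t * (s + t))"
    using *(3-5) by (simp add: divide_simps) (simp add: algebra_simps power2_eq_square)
  finally show ?thesis unfolding * by (simp add: algebra_simps)
qed

lemma bit_var_superadditive:
  assumes "a \<ge> 0" "b \<ge> 0" "c \<ge> 0" "d \<ge> 0"
  shows "bit_var a b + bit_var c d \<le> bit_var (a + c) (b + d)"
proof -
  consider "a = 0" "b = 0" | "c = 0" "d = 0" | "a + b > 0" "c + d > 0"
    using assms by linarith
  then show ?thesis
  proof cases
    case 3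
    have "0 \<le> 4 * (a * d - b * c)\<^sup>2 / ((a + b) * (c + d) * (a + b + c + d))"
      using assms by simp
    then show ?thesis using bit_var_split_eq[OF 3] by linarith
  qed (auto simp: bit_var_def)
qed

text \<open>The variance between the parts is paid for by the loss of Hellinger affinity. Its
  numerator factors through \<open>u - v\<close> and \<open>u + v\<close>: the square of the sum is
  at most \<open>A * B\<close> and cancels, AM-GM replaces \<open>A + B\<close> by
  \<open>2 * r\<close>, and the square of the difference contains the factor
  \<open>r - p - q\<close>.\<close>

lemma bit_var_split_le:
  assumes "a \<ge> 0" "b \<ge> 0" "c \<ge> 0" "d \<ge> 0"
  shows "bit_var (a + c) (b + d) - bit_var a b - bit_var c d
    \<le> 4 * (sqrt ((a + b) * (c + d)) - sqrt (a * c) - sqrt (b * d))"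
proof -
  consider "a = 0" "b = 0" | "c = 0" "d = 0" | "a + b > 0" "c + d > 0"
    using assms by linarith
  then show ?thesis
  proof cases
    case 3
    define A B where "A = a + b" and "B = c + d"
    have AB: "A > 0" "B > 0" using 3 by (auto simp: A_def B_def)
    define u v where "u = sqrt (a * d)" and "v = sqrt (b * c)"
    define p q where "p = sqrt (a * c)" and "q = sqrt (b * d)"
    define r where "r = sqrt (A * B)"
    have sq: "u\<^sup>2 = a * d" "v\<^sup>2 = b * c" "p\<^sup>2 = a * c" "q\<^sup>2 = b * d" "r\<^sup>2 = A * B"
      and nn: "u \<ge> 0" "v \<ge> 0" "p \<ge> 0" "q \<ge> 0" and r: "r > 0"
      using assms AB by (simp_all add: u_def v_def p_def q_def r_def)
    have uv_pq: "u * v = p * q"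
      by (simp add: u_def v_def p_def q_def real_sqrt_mult[symmetric] ac_simps)
    have exp: "A * B = u\<^sup>2 + v\<^sup>2 + p\<^sup>2 + q\<^sup>2"
      unfolding sq A_def B_def by (simp add: algebra_simps)
    have key: "r\<^sup>2 - (p + q)\<^sup>2 = (u - v)\<^sup>2"
      unfolding sq(5) exp using uv_pq by (simp add: power2_eq_square algebra_simps)
    have key2: "r\<^sup>2 - (u + v)\<^sup>2 = (p - q)\<^sup>2"
      unfolding sq(5) exp using uv_pq by (simp add: power2_eq_square algebra_simps)
    have pqr: "p + q \<le> r"
      by (rule power2_le_imp_le) (use key r zero_le_power2[of "u - v"] in linarith)+
    have uvr: "(u + v)\<^sup>2 \<le> A * B"
      using key2 zero_le_power2[of "p - q"] sq(5) by linarith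
    have amgm: "2 * r \<le> A + B"
      using arith_geo_mean_sqrt[of A B] AB by (simp add: r_def)
    have fac: "a * d - b * c = (u - v) * (u + v)"
      using sq by (simp add: power2_eq_square algebra_simps)
    have "bit_var (a + c) (b + d) - bit_var a b - bit_var c d
        = 4 * ((u - v)\<^sup>2 * (u + v)\<^sup>2) / (A * B * (A + B))"
      unfolding bit_var_split_eq[OF 3] fac A_def B_def by (simp add: power_mult_distrib add.assoc)
    also have "\<dots> \<le> 4 * ((u - v)\<^sup>2 * (A * B)) / (A * B * (A + B))"
      by (intro divide_right_mono mult_left_mono uvr) (use AB in auto)
    also have "\<dots> = 4 * (u - v)\<^sup>2 / (A + B)" using AB by simp
    also have "\<dots> \<le> 4 * (u - v)\<^sup>2 / (2 * r)"
      by (rule divide_left_mono) (use amgm r AB in auto)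
    also have "\<dots> \<le> 4 * (r - p - q)"
    proof -
      have "(u - v)\<^sup>2 = (r - p - q) * (r + (p + q))"
        unfolding key[symmetric] by (simp add: power2_eq_square algebra_simps)
      also have "\<dots> \<le> (r - p - q) * (r + r)"
        by (rule mult_left_mono) (use pqr in auto)
      finally have "4 * (u - v)\<^sup>2 \<le> 4 * (r - p - q) * (2 * r)" by (simp add: algebra_simps)
      with r show ?thesis by (intro iffD2[OF pos_divide_le_eq]) auto
    qed
    finally show ?thesis by (simp add: r_def p_def q_def A_def B_def)
  qed (auto simp: bit_var_def)
qed

section \<open>Conditional variances and innovations\<close>

text \<open>The mass of \<open>f\<close> times the expected variance of coordinate \<open>i\<close>
  given the coordinates before it.\<close>

definition cond_var :: "nat \<Rightarrow> (int list \<Rightarrow> real) \<Rightarrow> nat \<Rightarrow> real" where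
  "cond_var n f i = (\<Sum>k\<in>cube i. bit_var (prefix_mass n f (k @ [1])) (prefix_mass n f (k @ [-1])))"

text \<open>A prefix of mass 0 gets mean 0. For nonnegative \<open>f\<close> both weights vanish
  there, so the identities below survive this convention.\<close>

definition cond_mean :: "nat \<Rightarrow> (int list \<Rightarrow> real) \<Rightarrow> int list \<Rightarrow> real" where
  "cond_mean n f k = (prefix_mass n f (k @ [1]) - prefix_mass n f (k @ [-1]))
     / (prefix_mass n f (k @ [1]) + prefix_mass n f (k @ [-1]))"

text \<open>The martingale difference when the coordinates are exposed in increasing order.\<close>

definition innov :: "nat \<Rightarrow> (int list \<Rightarrow> real) \<Rightarrow> nat \<Rightarrow> int list \<Rightarrow> real" where
  "innov n f i x = real_of_int (x ! i) - cond_mean n f (take i x)"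

lemma mass_by_coord:
  assumes "i < n"
  shows "mass n f = (\<Sum>k\<in>cube i. prefix_mass n f (k @ [1]) + prefix_mass n f (k @ [-1]))"
  using sum_by_prefix_coord[OF assms, of f "\<lambda>_ _. 1"] by (simp add: mass_def)

lemma cond_var_le_mass:
  assumes "i < n" "\<And>x. f x \<ge> 0"
  shows "cond_var n f i \<le> mass n f"
  unfolding cond_var_def mass_by_coord[OF assms(1)]
  by (intro sum_mono bit_var_le prefix_mass_nonneg assms(2))

text \<open>Given the prefix, the innovation has mean zero, which makes it orthogonal to all
  functions of the earlier coordinates.\<close>

lemma innov_orth:
  assumes "i < n" and nn: "\<And>x. f x \<ge> 0" and u: "\<And>x. x \<in> cube n \<Longrightarrow> u x = U (take i x)"
  shows "(\<Sum>x\<in>cube n. f x * (u x * innov n f i x)) = 0"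
proof -
  have "(\<Sum>x\<in>cube n. f x * (u x * innov n f i x))
      = (\<Sum>x\<in>cube n. f x * (U (take i x) * (real_of_int (x ! i) - cond_mean n f (take i x))))"
    by (rule sum.cong) (auto simp: u innov_def)
  also have "\<dots> = (\<Sum>k\<in>cube i. prefix_mass n f (k @ [1]) * (U k * (real_of_int 1 - cond_mean n f k))
      + prefix_mass n f (k @ [-1]) * (U k * (real_of_int (-1) - cond_mean n f k)))"
    by (rule sum_by_prefix_coord[OF assms(1), where G = "\<lambda>k s. U k * (real_of_int s - cond_mean n f k)"])
  also have "\<dots> = 0"
  proof (rule sum.neutral, safe)
    fix k
    define p q where "p = prefix_mass n f (k @ [1])" and "q = prefix_mass n f (k @ [-1])"
    have pq: "p \<ge> 0" "q \<ge> 0" by (auto simp: p_def q_def intro: prefix_mass_nonneg nn)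
    have m: "cond_mean n f k * (p + q) = p - q"
      using pq by (cases "p + q = 0") (auto simp: cond_mean_def p_def q_def)
    have "p * (U k * (real_of_int 1 - cond_mean n f k)) + q * (U k * (real_of_int (-1) - cond_mean n f k))
        = U k * (p - q - cond_mean n f k * (p + q))"
      by (simp add: algebra_simps)
    also have "\<dots> = 0" unfolding m by simp
    finally show "prefix_mass n f (k @ [1]) * (U k * (real_of_int 1 - cond_mean n f k))
      + prefix_mass n f (k @ [-1]) * (U k * (real_of_int (-1) - cond_mean n f k)) = 0"
      by (simp add: p_def q_def)
  qed
  finally show ?thesis .
qed

text \<open>On each prefix, the covariance of a sign with its centred version is its
  variance.\<close>

lemma coord_innov:
  assumes "i < n" and nn: "\<And>x. f x \<ge> 0"
  shows "(\<Sum>x\<in>cube n. f x * (real_of_int (x ! i) * innov n f i x)) = cond_var n f i"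
proof -
  have "(\<Sum>x\<in>cube n. f x * (real_of_int (x ! i) * innov n f i x))
      = (\<Sum>k\<in>cube i. prefix_mass n f (k @ [1]) * (real_of_int 1 * (real_of_int 1 - cond_mean n f k))
      + prefix_mass n f (k @ [-1]) * (real_of_int (-1) * (real_of_int (-1) - cond_mean n f k)))"
    unfolding innov_def
    by (rule sum_by_prefix_coord[OF assms(1), where G = "\<lambda>k s. real_of_int s * (real_of_int s - cond_mean n f k)"])
  also have "\<dots> = cond_var n f i"
    unfolding cond_var_def
  proof (rule sum.cong[OF refl])
    fix k
    define p q where "p = prefix_mass n f (k @ [1])" and "q = prefix_mass n f (k @ [-1])"
    have pq: "p \<ge> 0" "q \<ge> 0" by (auto simp: p_def q_def intro: prefix_mass_nonneg nn)
    have m: "cond_mean n f k = (p - q) / (p + q)" by (simp add: cond_mean_def p_def q_def)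
    have "p * (1 - (p - q) / (p + q)) + q * (1 + (p - q) / (p + q)) = bit_var p q"
    proof (cases "p + q = 0")
      case True
      then have "p = 0" "q = 0" using pq by auto
      then show ?thesis by (simp add: bit_var_def)
    next
      case False
      then show ?thesis by (simp add: bit_var_def divide_simps)
    qed
    then show "prefix_mass n f (k @ [1]) * (real_of_int 1 * (real_of_int 1 - cond_mean n f k))
      + prefix_mass n f (k @ [-1]) * (real_of_int (-1) * (real_of_int (-1) - cond_mean n f k))
      = bit_var (prefix_mass n f (k @ [1])) (prefix_mass n f (k @ [-1]))"
      unfolding m p_def q_def by (simp add: add.commute)
  qed
  finally show ?thesis .
qed

text \<open>One of the two innovations can be replaced by the coordinate itself, because the
  conditional mean is a function of the prefix.\<close>

lemma innov_sq:
  assumes "i < n" and nn: "\<And>x. f x \<ge> 0"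
  shows "(\<Sum>x\<in>cube n. f x * (innov n f i x * innov n f i x)) = cond_var n f i"
proof -
  have "(\<Sum>x\<in>cube n. f x * (innov n f i x * innov n f i x))
      = (\<Sum>x\<in>cube n. f x * (real_of_int (x ! i) * innov n f i x))
        - (\<Sum>x\<in>cube n. f x * (cond_mean n f (take i x) * innov n f i x))"
    unfolding sum_subtractf[symmetric] by (rule sum.cong) (auto simp: innov_def algebra_simps)
  also have "(\<Sum>x\<in>cube n. f x * (cond_mean n f (take i x) * innov n f i x)) = 0"
    by (rule innov_orth[OF assms]) auto
  finally show ?thesis using coord_innov[OF assms] by simp
qed

lemma earlier_coord_innov:
  assumes "i < n" "k < i" and nn: "\<And>x. f x \<ge> 0"
  shows "(\<Sum>x\<in>cube n. f x * (real_of_int (x ! k) * innov n f i x)) = 0"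
  by (rule innov_orth[OF assms(1) nn, where U = "\<lambda>l. real_of_int (l ! k)"]) (use assms in auto)

text \<open>The innovation of smaller index is a function of the prefix that precedes the larger
  index, so the later innovation is orthogonal to it.\<close>

lemma innov_innov:
  assumes "i < n" "k < n" "i \<noteq> k" and nn: "\<And>x. f x \<ge> 0"
  shows "(\<Sum>x\<in>cube n. f x * (innov n f k x * innov n f i x)) = 0"
proof -
  have lt: "(\<Sum>x\<in>cube n. f x * (innov n f k x * innov n f i x)) = 0" if "i < n" "k < i" for i k
    by (rule innov_orth[OF that(1) nn, where U = "innov n f k"])
      (use that in \<open>auto simp: innov_def min_absorb1\<close>)
  show ?thesis
    using lt[of i k] lt[of k i] assms by (cases "k < i") (auto simp: mult.commute)
qed

section \<open>Inner product and sums over weighted rectangles\<close>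

text \<open>\<open>T\<close> holds the free coordinates. Bob's string is stored reversed, with his
  coordinate \<open>i\<close> at index \<open>n - 1 - i\<close>: prefixes of it are suffixes of his
  input, so the same prefix notions expose his coordinates in the opposite order.\<close>

definition restr_ip :: "nat \<Rightarrow> nat set \<Rightarrow> int list \<Rightarrow> int list \<Rightarrow> real" where
  "restr_ip n T x y = (\<Sum>i\<in>T. real_of_int (x ! i) * real_of_int (y ! (n - 1 - i)))"

definition pair_sum :: "nat \<Rightarrow> (int list \<Rightarrow> real) \<Rightarrow> (int list \<Rightarrow> real) \<Rightarrow> (int list \<Rightarrow> int list \<Rightarrow> real) \<Rightarrow> real" where
  "pair_sum n f g K = (\<Sum>x\<in>cube n. \<Sum>y\<in>cube n. f x * g y * K x y)"

lemma pair_sum_cong: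
  "(\<And>x y. x \<in> cube n \<Longrightarrow> y \<in> cube n \<Longrightarrow> K x y = L x y) \<Longrightarrow> pair_sum n f g K = pair_sum n f g L"
  by (simp add: pair_sum_def)

lemma pair_sum_add: "pair_sum n f g (\<lambda>x y. K x y + L x y) = pair_sum n f g K + pair_sum n f g L"
  by (simp add: pair_sum_def sum.distrib distrib_left)

lemma pair_sum_diff: "pair_sum n f g (\<lambda>x y. K x y - L x y) = pair_sum n f g K - pair_sum n f g L"
  by (simp add: pair_sum_def sum_subtractf right_diff_distrib)

lemma pair_sum_scale: "pair_sum n f g (\<lambda>x y. c * K x y) = c * pair_sum n f g K"
  by (simp add: pair_sum_def sum_distrib_left ac_simps)

lemma pair_sum_sum: "pair_sum n f g (\<lambda>x y. \<Sum>i\<in>I. K i x y) = (\<Sum>i\<in>I. pair_sum n f g (K i))"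
proof -
  have "pair_sum n f g (\<lambda>x y. \<Sum>i\<in>I. K i x y) = (\<Sum>x\<in>cube n. \<Sum>i\<in>I. \<Sum>y\<in>cube n. f x * g y * K i x y)"
    unfolding pair_sum_def sum_distrib_left by (intro sum.cong refl sum.swap)
  also have "\<dots> = (\<Sum>i\<in>I. pair_sum n f g (K i))"
    unfolding pair_sum_def by (rule sum.swap)
  finally show ?thesis .
qed

lemma pair_sum_prod:
  "pair_sum n f g (\<lambda>x y. a x * b y) = (\<Sum>x\<in>cube n. f x * a x) * (\<Sum>y\<in>cube n. g y * b y)"
  by (simp add: pair_sum_def sum_product ac_simps)

lemma pair_sum_const: "pair_sum n f g (\<lambda>x y. c) = c * (mass n f * mass n g)"
  using pair_sum_prod[of n f g "\<lambda>_. c" "\<lambda>_. 1"]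
  by (simp add: mass_def sum_distrib_right[symmetric])

lemma pair_sum_nonneg:
  assumes "\<And>x. f x \<ge> 0" "\<And>y. g y \<ge> 0" "\<And>x y. K x y \<ge> 0"
  shows "pair_sum n f g K \<ge> 0"
  unfolding pair_sum_def by (intro sum_nonneg mult_nonneg_nonneg assms)

text \<open>Each term factors into a sum over \<open>x\<close> and a sum over \<open>y\<close>. A
  cross term therefore vanishes as soon as one of the two sides is orthogonal.\<close>

lemma pair_sum_bilinear:
  "pair_sum n f g (\<lambda>x y. (\<Sum>k\<in>T. a k x * b k y) * (\<Sum>i\<in>T. a' i x * b' i y))
    = (\<Sum>k\<in>T. \<Sum>i\<in>T. (\<Sum>x\<in>cube n. f x * (a k x * a' i x)) * (\<Sum>y\<in>cube n. g y * (b k y * b' i y)))"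
proof -
  have "pair_sum n f g (\<lambda>x y. (\<Sum>k\<in>T. a k x * b k y) * (\<Sum>i\<in>T. a' i x * b' i y))
      = pair_sum n f g (\<lambda>x y. \<Sum>k\<in>T. \<Sum>i\<in>T. (a k x * a' i x) * (b k y * b' i y))"
    unfolding sum_product by (simp add: ac_simps)
  then show ?thesis by (simp only: pair_sum_sum pair_sum_prod)
qed

lemma sum_sum_diag:
  assumes "finite T" "\<And>k i. k \<in> T \<Longrightarrow> i \<in> T \<Longrightarrow> k \<noteq> i \<Longrightarrow> F k i = (0::real)"
  shows "(\<Sum>k\<in>T. \<Sum>i\<in>T. F k i) = (\<Sum>k\<in>T. F k k)"
proof (rule sum.cong[OF refl])
  fix k assume "k \<in> T"
  then have "(\<Sum>i\<in>T. F k i) = (\<Sum>i\<in>{k}. F k i)"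
    by (intro sum.mono_neutral_right) (use assms in auto)
  then show "(\<Sum>i\<in>T. F k i) = F k k" by simp
qed

section \<open>Deficit of a rectangle and Bessel's inequality\<close>

text \<open>Second moment of the inner product minus the potential, both unnormalised. It vanishes
  for suitable subcubes, its total grows by a bounded amount per bit, and at a leaf it controls the
  squared mean.\<close>

definition deficit :: "nat \<Rightarrow> nat set \<Rightarrow> (int list \<Rightarrow> real) \<Rightarrow> (int list \<Rightarrow> real) \<Rightarrow> real" where
  "deficit n T f g = pair_sum n f g (\<lambda>x y. (restr_ip n T x y)\<^sup>2)
     - (\<Sum>i\<in>T. cond_var n f i * cond_var n g (n - 1 - i))"

text \<open>Bessel's inequality for the orthogonal system consisting of the constant \<open>1\<close> and the products
  of innovations: the two players expose their coordinates in opposite orders (Bob's strings are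
  reversed), so each coordinate product \<open>x ! k * y ! (n - 1 - k)\<close> is orthogonal to every
  innovation product except the \<open>k\<close>-th.\<close>
lemma deficit_quadratic:
  assumes T: "T \<subseteq> {..<n}" and f: "\<And>x. f x \<ge> 0" and g: "\<And>y. g y \<ge> 0"
  shows "0 \<le> deficit n T f g - 2 * c * pair_sum n f g (restr_ip n T) + c\<^sup>2 * (mass n f * mass n g)"
proof -
  define H where "H = restr_ip n T"
  define \<Psi> where "\<Psi> x y = (\<Sum>i\<in>T. innov n f i x * innov n g (n - 1 - i) y)" for x y
  define \<Phi> where "\<Phi> = (\<Sum>i\<in>T. cond_var n f i * cond_var n g (n - 1 - i))"
  have fin: "finite T" using T finite_subset by blast
  have lt: "i < n" "n - 1 - i < n" if "i \<in> T" for i using T that by auto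
  have H\<Psi>: "pair_sum n f g (\<lambda>x y. H x y * \<Psi> x y) = \<Phi>"
  proof -
    have "pair_sum n f g (\<lambda>x y. H x y * \<Psi> x y)
      = (\<Sum>k\<in>T. \<Sum>i\<in>T. (\<Sum>x\<in>cube n. f x * (real_of_int (x ! k) * innov n f i x))
        * (\<Sum>y\<in>cube n. g y * (real_of_int (y ! (n - 1 - k)) * innov n g (n - 1 - i) y)))"
      unfolding H_def restr_ip_def \<Psi>_def by (rule pair_sum_bilinear)
    also have "\<dots> = (\<Sum>k\<in>T. (\<Sum>x\<in>cube n. f x * (real_of_int (x ! k) * innov n f k x))
        * (\<Sum>y\<in>cube n. g y * (real_of_int (y ! (n - 1 - k)) * innov n g (n - 1 - k) y)))"
    proof (rule sum_sum_diag[OF fin])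
      fix k i assume ki: "k \<in> T" "i \<in> T" "k \<noteq> i"
      \<comment> \<open>Whichever of the two coordinates comes first for Alice comes last for Bob,
        so coordinate \<open>k\<close> precedes innovation \<open>i\<close> in exactly one of the
        orders, and that factor is 0.\<close>
      then consider "k < i" | "n - 1 - k < n - 1 - i" using lt by fastforce
      then show "(\<Sum>x\<in>cube n. f x * (real_of_int (x ! k) * innov n f i x))
        * (\<Sum>y\<in>cube n. g y * (real_of_int (y ! (n - 1 - k)) * innov n g (n - 1 - i) y)) = 0"
        using earlier_coord_innov[OF lt(1) _ f, OF ki(2)] earlier_coord_innov[OF lt(2) _ g, OF ki(2)]
        by cases auto
    qed
    also have "\<dots> = \<Phi>" unfolding \<Phi>_def
      by (intro sum.cong refl arg_cong2[where f = "(*)"] coord_innov lt f g)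
    finally show ?thesis .
  qed
  have \<Psi>\<Psi>: "pair_sum n f g (\<lambda>x y. \<Psi> x y * \<Psi> x y) = \<Phi>"
  proof -
    have "pair_sum n f g (\<lambda>x y. \<Psi> x y * \<Psi> x y)
      = (\<Sum>k\<in>T. \<Sum>i\<in>T. (\<Sum>x\<in>cube n. f x * (innov n f k x * innov n f i x))
        * (\<Sum>y\<in>cube n. g y * (innov n g (n - 1 - k) y * innov n g (n - 1 - i) y)))"
      unfolding \<Psi>_def by (rule pair_sum_bilinear)
    also have "\<dots> = (\<Sum>k\<in>T. (\<Sum>x\<in>cube n. f x * (innov n f k x * innov n f k x))
        * (\<Sum>y\<in>cube n. g y * (innov n g (n - 1 - k) y * innov n g (n - 1 - k) y)))"
      by (rule sum_sum_diag[OF fin]) (use innov_innov[OF _ _ _ f] lt in auto)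
    also have "\<dots> = \<Phi>" unfolding \<Phi>_def
      by (intro sum.cong refl arg_cong2[where f = "(*)"] innov_sq lt f g)
    finally show ?thesis .
  qed
  have \<Psi>1: "pair_sum n f g \<Psi> = 0"
  proof -
    have "pair_sum n f g \<Psi> = (\<Sum>i\<in>T. (\<Sum>x\<in>cube n. f x * innov n f i x)
        * (\<Sum>y\<in>cube n. g y * innov n g (n - 1 - i) y))"
      unfolding \<Psi>_def pair_sum_sum pair_sum_prod ..
    also have "\<dots> = 0"
      by (rule sum.neutral) (use innov_orth[OF lt(1) f, where u = "\<lambda>_. 1" and U = "\<lambda>_. 1"] in auto)
    finally show ?thesis .
  qed
  \<comment> \<open>The residual after removal of both the constant \<open>c\<close> and the
    innovation part has nonnegative square; the relations above collapse its expansion.\<close>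
  have "0 \<le> pair_sum n f g (\<lambda>x y. (H x y - c - \<Psi> x y)\<^sup>2)"
    by (rule pair_sum_nonneg) (use f g in auto)
  also have "\<dots> = pair_sum n f g (\<lambda>x y. (H x y)\<^sup>2 - 2 * c * H x y + c\<^sup>2
      - 2 * (H x y * \<Psi> x y) + \<Psi> x y * \<Psi> x y + 2 * c * \<Psi> x y)"
    by (rule pair_sum_cong) (simp add: power2_eq_square algebra_simps)
  also have "\<dots> = pair_sum n f g (\<lambda>x y. (H x y)\<^sup>2) - 2 * c * pair_sum n f g H
      + c\<^sup>2 * (mass n f * mass n g) - 2 * \<Phi> + \<Phi> + 2 * c * 0"
    unfolding pair_sum_add pair_sum_diff pair_sum_scale H\<Psi> \<Psi>\<Psi> \<Psi>1 pair_sum_const ..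
  finally show ?thesis by (simp add: deficit_def H_def \<Phi>_def)
qed

lemma deficit_nonneg:
  assumes "T \<subseteq> {..<n}" "\<And>x. f x \<ge> 0" "\<And>y. g y \<ge> 0"
  shows "deficit n T f g \<ge> 0"
  using deficit_quadratic[OF assms, where c = 0] by simp

text \<open>The quadratic in \<open>c\<close> from \<open>deficit_quadratic\<close> is never
  negative; its value at the mean \<open>c = A / M\<close> gives the claim.\<close>

lemma deficit_bessel:
  assumes T: "T \<subseteq> {..<n}" and f: "\<And>x. f x \<ge> 0" and g: "\<And>y. g y \<ge> 0"
  shows "(pair_sum n f g (restr_ip n T))\<^sup>2 \<le> mass n f * mass n g * deficit n T f g"
proof -
  define A M where "A = pair_sum n f g (restr_ip n T)" and "M = mass n f * mass n g"
  have quad: "0 \<le> deficit n T f g - 2 * c * A + c\<^sup>2 * M" for c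
    using deficit_quadratic[OF assms] by (simp add: A_def M_def)
  have M0: "M \<ge> 0" unfolding M_def using mass_nonneg f g by simp
  have "A\<^sup>2 \<le> M * deficit n T f g"
  proof (cases "M = 0")
    case True
    then have "0 \<le> deficit n T f g - 2 * c * A" for c using quad[of c] by simp
    \<comment> \<open>For nonzero \<open>A\<close> this choice of \<open>c\<close> would make the
      right side -1.\<close>
    from this[of "(deficit n T f g + 1) / (2 * A)"] have "A = 0"
      by (cases "A = 0") auto
    with True show ?thesis by simp
  next
    case False
    with quad[of "A / M"] have "0 \<le> deficit n T f g - A\<^sup>2 / M"
      by (simp add: power2_eq_square)
    with False M0 show ?thesis by (simp add: divide_le_eq mult.commute)
  qed
  then show ?thesis by (simp add: A_def M_def)
qed

section \<open>Cost of one bit of communication\<close>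

lemma cond_var_superadditive:
  assumes "\<And>x. f x \<ge> 0" "\<And>x. f' x \<ge> 0"
  shows "cond_var n f i + cond_var n f' i \<le> cond_var n (\<lambda>x. f x + f' x) i"
  unfolding cond_var_def sum.distrib[symmetric] prefix_mass_add
  by (intro sum_mono bit_var_superadditive prefix_mass_nonneg assms)

text \<open>The drop at coordinate \<open>i\<close> is paid for by the decrease, when the prefix is extended by that
  coordinate, of the Hellinger affinity of the two parts.\<close>
lemma cond_var_split:
  assumes f: "\<And>x. f x \<ge> 0" and f': "\<And>x. f' x \<ge> 0"
  shows "(\<Sum>i<n. cond_var n (\<lambda>x. f x + f' x) i - cond_var n f i - cond_var n f' i)
    \<le> 2 * mass n (\<lambda>x. f x + f' x)"
proof -
  define R where "R i = (\<Sum>k\<in>cube i. sqrt (prefix_mass n f k * prefix_mass n f' k))" for i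
  have step: "cond_var n (\<lambda>x. f x + f' x) i - cond_var n f i - cond_var n f' i \<le> 4 * (R i - R (Suc i))"
    if "i < n" for i
  proof -
    have "cond_var n (\<lambda>x. f x + f' x) i - cond_var n f i - cond_var n f' i
      \<le> (\<Sum>k\<in>cube i. 4 * (sqrt (prefix_mass n f k * prefix_mass n f' k)
          - sqrt (prefix_mass n f (k @ [1]) * prefix_mass n f' (k @ [1]))
          - sqrt (prefix_mass n f (k @ [-1]) * prefix_mass n f' (k @ [-1]))))"
      unfolding cond_var_def sum_subtractf[symmetric] prefix_mass_add
    proof (rule sum_mono)
      fix k assume "k \<in> cube i"
      note split = prefix_mass_split[OF that this]
      show "bit_var (prefix_mass n f (k @ [1]) + prefix_mass n f' (k @ [1]))
          (prefix_mass n f (k @ [-1]) + prefix_mass n f' (k @ [-1]))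
        - bit_var (prefix_mass n f (k @ [1])) (prefix_mass n f (k @ [-1]))
        - bit_var (prefix_mass n f' (k @ [1])) (prefix_mass n f' (k @ [-1]))
        \<le> 4 * (sqrt (prefix_mass n f k * prefix_mass n f' k)
          - sqrt (prefix_mass n f (k @ [1]) * prefix_mass n f' (k @ [1]))
          - sqrt (prefix_mass n f (k @ [-1]) * prefix_mass n f' (k @ [-1])))"
        unfolding split[of f] split[of f']
        by (rule bit_var_split_le) (intro prefix_mass_nonneg f f')+
    qed
    also have "\<dots> = 4 * (R i - R (Suc i))"
      by (simp add: R_def sum_cube_Suc sum_distrib_left[symmetric] sum_subtractf sum.distrib)
    finally show ?thesis .
  qed
  have "(\<Sum>i<n. cond_var n (\<lambda>x. f x + f' x) i - cond_var n f i - cond_var n f' i)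
      \<le> (\<Sum>i<n. 4 * (R i - R (Suc i)))"
    by (rule sum_mono) (simp only: step lessThan_iff)
  also have "\<dots> = 4 * (R 0 - R n)"
    by (simp only: sum_distrib_left[symmetric] sum_lessThan_telescope')
  \<comment> \<open>\<open>R n\<close> is nonnegative, and \<open>R 0\<close> is the affinity of the
    total masses, since the empty prefix is the only one of length 0.\<close>
  also have "\<dots> \<le> 4 * sqrt (mass n f * mass n f')"
    by (simp add: R_def sum_nonneg prefix_mass_nonneg f f')
  also have "\<dots> \<le> 2 * mass n (\<lambda>x. f x + f' x)"
    using arith_geo_mean_sqrt[of "mass n f" "mass n f'"] mass_nonneg[of f n, OF f] mass_nonneg[of f' n, OF f']
    by (simp add: mass_add)
  finally show ?thesis .
qed

lemma pair_sum_add_left: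
  "pair_sum n (\<lambda>x. f x + f' x) g K = pair_sum n f g K + pair_sum n f' g K"
  by (simp add: pair_sum_def sum.distrib distrib_right)

lemma pair_sum_commute: "pair_sum n f g K = pair_sum n g f (\<lambda>x y. K y x)"
  unfolding pair_sum_def by (subst sum.swap) (simp add: ac_simps)

lemma sum_reflect:
  assumes "T \<subseteq> {..<n}"
  shows "(\<Sum>i\<in>T. F i (n - 1 - i)) = (\<Sum>i\<in>(\<lambda>i. n - 1 - i) ` T. F (n - 1 - i) (i::nat) :: real)"
proof -
  have inv: "n - 1 - (n - 1 - i) = i" if "i \<in> T" for i using assms that by auto
  then have "inj_on (\<lambda>i. n - 1 - i) T" by (rule inj_on_inverseI[where g = "\<lambda>i. n - 1 - i"])
  then have "(\<Sum>i\<in>(\<lambda>i. n - 1 - i) ` T. F (n - 1 - i) i) = (\<Sum>i\<in>T. F (n - 1 - (n - 1 - i)) (n - 1 - i))"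
    by (simp only: sum.reindex o_def)
  also have "\<dots> = (\<Sum>i\<in>T. F i (n - 1 - i))"
    by (rule sum.cong[OF refl]) (simp only: inv)
  finally show ?thesis ..
qed

text \<open>The pairing of \<open>i\<close> with \<open>n - 1 - i\<close> is an involution, so
  exchanging the players only reflects \<open>T\<close>. This carries the bound for Alice's messages
  over to Bob's.\<close>

lemma deficit_commute:
  assumes T: "T \<subseteq> {..<n}"
  shows "deficit n T f g = deficit n ((\<lambda>i. n - 1 - i) ` T) g f"
proof -
  define T' where "T' = (\<lambda>i. n - 1 - i) ` T"
  note flip = sum_reflect[OF T, folded T'_def]
  have "restr_ip n T x y = restr_ip n T' y x" for x y
    unfolding restr_ip_def using flip[of "\<lambda>i j. real_of_int (x ! i) * real_of_int (y ! j)"]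
    by (simp add: mult.commute)
  moreover have "(\<Sum>i\<in>T. cond_var n f i * cond_var n g (n - 1 - i))
      = (\<Sum>i\<in>T'. cond_var n g i * cond_var n f (n - 1 - i))"
    using flip[of "\<lambda>i j. cond_var n f i * cond_var n g j"] by (simp add: mult.commute)
  ultimately show ?thesis
    unfolding deficit_def T'_def[symmetric] by (subst pair_sum_commute) (simp only:)
qed

text \<open>Second moments add up exactly when \<open>f\<close> is split, so only the potential
  changes. Bob's factors are at most \<open>mass n g\<close>, and \<open>cond_var_split\<close>
  bounds the total drop on Alice's side.\<close>

lemma deficit_split_left:
  assumes T: "T \<subseteq> {..<n}" and f: "\<And>x. f x \<ge> 0" and f': "\<And>x. f' x \<ge> 0" and g: "\<And>y. g y \<ge> 0"
  shows "deficit n T f g + deficit n T f' g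
    \<le> deficit n T (\<lambda>x. f x + f' x) g + 2 * (mass n (\<lambda>x. f x + f' x) * mass n g)"
proof -
  define D where "D i = cond_var n (\<lambda>x. f x + f' x) i - cond_var n f i - cond_var n f' i" for i
  have D0: "D i \<ge> 0" for i using cond_var_superadditive[of f f' n i] f f' by (simp add: D_def)
  have "deficit n T f g + deficit n T f' g - deficit n T (\<lambda>x. f x + f' x) g
      = (\<Sum>i\<in>T. D i * cond_var n g (n - 1 - i))"
    by (simp add: deficit_def pair_sum_add_left D_def left_diff_distrib sum_subtractf)
  also have "\<dots> \<le> (\<Sum>i\<in>T. D i * mass n g)"
    using T by (intro sum_mono mult_left_mono cond_var_le_mass D0 g) auto
  also have "\<dots> \<le> (\<Sum>i<n. D i * mass n g)"
    using T by (intro sum_mono2 mult_nonneg_nonneg D0 mass_nonneg g) auto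
  also have "\<dots> \<le> 2 * mass n (\<lambda>x. f x + f' x) * mass n g"
    unfolding sum_distrib_right[symmetric] D_def
    by (intro mult_right_mono cond_var_split f f' mass_nonneg g)
  finally show ?thesis by simp
qed

lemma deficit_split_right:
  assumes T: "T \<subseteq> {..<n}" and f: "\<And>x. f x \<ge> 0" and g: "\<And>y. g y \<ge> 0" and g': "\<And>y. g' y \<ge> 0"
  shows "deficit n T f g + deficit n T f g'
    \<le> deficit n T f (\<lambda>y. g y + g' y) + 2 * (mass n f * mass n (\<lambda>y. g y + g' y))"
proof -
  have "(\<lambda>i. n - 1 - i) ` T \<subseteq> {..<n}" using T by auto
  from deficit_split_left[OF this g g' f] show ?thesis
    unfolding deficit_commute[OF T, symmetric] by (simp only: mult.commute)
qed

section \<open>Correlation of a protocol on a rectangle\<close>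

text \<open>Cauchy-Schwarz in the plane; it merges the bounds for the two subtrees of a protocol
  node.\<close>

lemma sqrt_add_cauchy:
  assumes "a \<ge> 0" "b \<ge> 0" "c \<ge> 0" "d \<ge> (0::real)"
  shows "sqrt (a * c) + sqrt (b * d) \<le> sqrt ((a + b) * (c + d))"
proof (rule real_le_rsqrt)
  have "(sqrt (a * c) + sqrt (b * d))\<^sup>2 = a * c + b * d + 2 * sqrt ((a * d) * (b * c))"
  proof -
    have "sqrt (a * c) * sqrt (b * d) = sqrt ((a * d) * (b * c))"
      by (simp only: real_sqrt_mult ac_simps)
    then show ?thesis using assms by (simp add: power2_sum)
  qed
  also have "\<dots> \<le> a * c + b * d + (a * d + b * c)"
    using arith_geo_mean_sqrt[of "a * d" "b * c"] assms by simp
  finally show "(sqrt (a * c) + sqrt (b * d))\<^sup>2 \<le> (a + b) * (c + d)" by (simp add: algebra_simps)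
qed

text \<open>Bob's inputs are read in reverse, to match the indexing of \<^const>\<open>restr_ip\<close>.\<close>
lemma protocol_correlation:
  assumes T: "T \<subseteq> {..<n}" and "pm1_outputs P" "comm P \<le> d"
    and "\<And>x. f x \<ge> 0" "\<And>y. g y \<ge> 0"
  shows "\<bar>pair_sum n f g (\<lambda>x y. real_of_int (run P x (rev y)) * restr_ip n T x y)\<bar>
    \<le> sqrt (mass n f * mass n g * (deficit n T f g + 2 * real d * (mass n f * mass n g)))"
  using assms(2-)
proof (induction P arbitrary: d f g)
  case (Leaf b)
  let ?A = "pair_sum n f g (restr_ip n T)"
  \<comment> \<open>A constant output leaves only the mean of the inner product, which Bessel's
    inequality controls.\<close>
  have "\<bar>?A\<bar> \<le> sqrt (mass n f * mass n g * deficit n T f g)"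
    using deficit_bessel[OF T Leaf.prems(3,4)] real_le_rsqrt[of "\<bar>?A\<bar>"] by simp
  also have "\<dots> \<le> sqrt (mass n f * mass n g * (deficit n T f g + 2 * real d * (mass n f * mass n g)))"
    using mass_nonneg[of f n, OF Leaf.prems(3)] mass_nonneg[of g n, OF Leaf.prems(4)]
    by (intro real_sqrt_le_mono mult_left_mono) auto
  finally show ?case
    using Leaf.prems(1) pair_sum_scale[of n f g "real_of_int b" "restr_ip n T"] by (auto simp: abs_mult)
next
  case (Alice a P Q)
  define K where "K R = (\<lambda>x y. real_of_int (run R x (rev y)) * restr_ip n T x y)" for R
  \<comment> \<open>Zeroing the weight instead of shrinking the domain keeps both parts on the full
    cube, where the induction hypotheses apply.\<close>
  define f0 where "f0 x = (if a x then f x else 0)" for x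
  define f1 where "f1 x = (if a x then 0 else f x)" for x
  obtain e where d: "d = Suc e" "comm P \<le> e" "comm Q \<le> e"
    using Alice.prems(2) by (cases d) auto
  have nn: "f0 x \<ge> 0" "f1 x \<ge> 0" for x using Alice.prems(3) by (auto simp: f0_def f1_def)
  have f: "f = (\<lambda>x. f0 x + f1 x)" by (auto simp: f0_def f1_def)
  have g: "g y \<ge> 0" for y by (rule Alice.prems(4))
  define F0 F1 G where "F0 = mass n f0" and "F1 = mass n f1" and "G = mass n g"
  have FG: "F0 \<ge> 0" "F1 \<ge> 0" "G \<ge> 0" by (auto simp: F0_def F1_def G_def intro: mass_nonneg nn g)
  have mf: "mass n f = F0 + F1" unfolding f mass_add F0_def F1_def ..
  define W0 W1 where "W0 = deficit n T f0 g" and "W1 = deficit n T f1 g"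
  have W: "W0 \<ge> 0" "W1 \<ge> 0" unfolding W0_def W1_def by (intro deficit_nonneg[OF T] nn g)+
  have split: "W0 + W1 \<le> deficit n T f g + 2 * (mass n f * G)"
    using deficit_split_left[OF T nn g] unfolding f W0_def W1_def G_def by simp
  have IH0: "\<bar>pair_sum n f0 g (K P)\<bar> \<le> sqrt (F0 * G * (W0 + 2 * real e * (F0 * G)))"
    unfolding K_def F0_def G_def W0_def using Alice.prems(1) d by (intro Alice.IH(1) nn g) auto
  have IH1: "\<bar>pair_sum n f1 g (K Q)\<bar> \<le> sqrt (F1 * G * (W1 + 2 * real e * (F1 * G)))"
    unfolding K_def F1_def G_def W1_def using Alice.prems(1) d by (intro Alice.IH(2) nn g) auto
  have "pair_sum n f g (K (Alice a P Q)) = pair_sum n f0 g (K P) + pair_sum n f1 g (K Q)"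
    unfolding pair_sum_def sum.distrib[symmetric]
    by (intro sum.cong refl) (simp add: f0_def f1_def K_def)
  then have "\<bar>pair_sum n f g (K (Alice a P Q))\<bar>
      \<le> sqrt (F0 * G * (W0 + 2 * real e * (F0 * G))) + sqrt (F1 * G * (W1 + 2 * real e * (F1 * G)))"
    using IH0 IH1 by linarith
  also have "\<dots> \<le> sqrt ((F0 * G + F1 * G) * ((W0 + 2 * real e * (F0 * G)) + (W1 + 2 * real e * (F1 * G))))"
    by (intro sqrt_add_cauchy add_nonneg_nonneg mult_nonneg_nonneg FG W) auto
  also have "\<dots> \<le> sqrt (mass n f * G * (deficit n T f g + 2 * real d * (mass n f * G)))"
  proof (rule real_sqrt_le_mono)
    \<comment> \<open>\<open>split\<close> charges this message twice the product of the masses,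
      which is the step from \<open>e\<close> to \<open>Suc e\<close>.\<close>
    have "(W0 + 2 * real e * (F0 * G)) + (W1 + 2 * real e * (F1 * G))
        \<le> deficit n T f g + 2 * real d * (mass n f * G)"
      using split unfolding d(1) mf by (simp add: algebra_simps)
    then show "(F0 * G + F1 * G) * ((W0 + 2 * real e * (F0 * G)) + (W1 + 2 * real e * (F1 * G)))
        \<le> mass n f * G * (deficit n T f g + 2 * real d * (mass n f * G))"
      unfolding mf distrib_right[symmetric] using FG by (intro mult_left_mono) auto
  qed
  finally show ?case by (simp add: K_def G_def)
next
  case (Bob b P Q)
  define K where "K R = (\<lambda>x y. real_of_int (run R x (rev y)) * restr_ip n T x y)" for R
  \<comment> \<open>Bob's weight lives on reversed strings, whereas his message depends on the
    actual input \<open>rev y\<close>.\<close>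
  define g0 where "g0 y = (if b (rev y) then g y else 0)" for y
  define g1 where "g1 y = (if b (rev y) then 0 else g y)" for y
  obtain e where d: "d = Suc e" "comm P \<le> e" "comm Q \<le> e"
    using Bob.prems(2) by (cases d) auto
  have nn: "g0 y \<ge> 0" "g1 y \<ge> 0" for y using Bob.prems(4) by (auto simp: g0_def g1_def)
  have g: "g = (\<lambda>y. g0 y + g1 y)" by (auto simp: g0_def g1_def)
  have f: "f x \<ge> 0" for x by (rule Bob.prems(3))
  define F G0 G1 where "F = mass n f" and "G0 = mass n g0" and "G1 = mass n g1"
  have FG: "F \<ge> 0" "G0 \<ge> 0" "G1 \<ge> 0" by (auto simp: F_def G0_def G1_def intro: mass_nonneg nn f)
  have mg: "mass n g = G0 + G1" unfolding g mass_add G0_def G1_def ..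
  define W0 W1 where "W0 = deficit n T f g0" and "W1 = deficit n T f g1"
  have W: "W0 \<ge> 0" "W1 \<ge> 0" unfolding W0_def W1_def by (intro deficit_nonneg[OF T] nn f)+
  have split: "W0 + W1 \<le> deficit n T f g + 2 * (F * mass n g)"
    using deficit_split_right[OF T f nn] unfolding g W0_def W1_def F_def by simp
  have IH0: "\<bar>pair_sum n f g0 (K P)\<bar> \<le> sqrt (F * G0 * (W0 + 2 * real e * (F * G0)))"
    unfolding K_def F_def G0_def W0_def using Bob.prems(1) d by (intro Bob.IH(1) nn f) auto
  have IH1: "\<bar>pair_sum n f g1 (K Q)\<bar> \<le> sqrt (F * G1 * (W1 + 2 * real e * (F * G1)))"
    unfolding K_def F_def G1_def W1_def using Bob.prems(1) d by (intro Bob.IH(2) nn f) auto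
  have "pair_sum n f g (K (Bob b P Q)) = pair_sum n f g0 (K P) + pair_sum n f g1 (K Q)"
    unfolding pair_sum_def sum.distrib[symmetric]
    by (intro sum.cong refl) (simp add: g0_def g1_def K_def)
  then have "\<bar>pair_sum n f g (K (Bob b P Q))\<bar>
      \<le> sqrt (F * G0 * (W0 + 2 * real e * (F * G0))) + sqrt (F * G1 * (W1 + 2 * real e * (F * G1)))"
    using IH0 IH1 by linarith
  also have "\<dots> \<le> sqrt ((F * G0 + F * G1) * ((W0 + 2 * real e * (F * G0)) + (W1 + 2 * real e * (F * G1))))"
    by (intro sqrt_add_cauchy add_nonneg_nonneg mult_nonneg_nonneg FG W) auto
  also have "\<dots> \<le> sqrt (F * mass n g * (deficit n T f g + 2 * real d * (F * mass n g)))"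
  proof (rule real_sqrt_le_mono)
    have "(W0 + 2 * real e * (F * G0)) + (W1 + 2 * real e * (F * G1))
        \<le> deficit n T f g + 2 * real d * (F * mass n g)"
      using split unfolding d(1) mg by (simp add: algebra_simps)
    then show "(F * G0 + F * G1) * ((W0 + 2 * real e * (F * G0)) + (W1 + 2 * real e * (F * G1)))
        \<le> F * mass n g * (deficit n T f g + 2 * real d * (F * mass n g))"
      unfolding mg distrib_left[symmetric] using FG by (intro mult_left_mono) auto
  qed
  finally show ?case by (simp add: K_def F_def)
qed

section \<open>Subcubes and their deficit\<close>

definition subcube :: "nat set \<Rightarrow> (nat \<Rightarrow> int) \<Rightarrow> int list \<Rightarrow> real" where
  "subcube J v x = (\<Prod>j\<in>J. of_bool (x ! j = v j))"

lemma subcube_nonneg: "subcube J v x \<ge> 0"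
  unfolding subcube_def by (rule prod_nonneg) auto

lemma sum_cube_prod:
  "(\<Sum>x\<in>cube n. \<Prod>i<n. \<phi> i (x ! i)) = (\<Prod>i<n. \<phi> i 1 + \<phi> i (-1) :: real)"
proof (induction n)
  case (Suc n)
  have "(\<Sum>x\<in>cube (Suc n). \<Prod>i<Suc n. \<phi> i (x ! i))
      = (\<Sum>k\<in>cube n. (\<Prod>i<n. \<phi> i (k ! i)) * (\<phi> n 1 + \<phi> n (-1)))"
    unfolding sum_cube_Suc
    by (intro sum.cong refl) (simp add: cube_length nth_append distrib_left)
  then show ?case using Suc by (simp add: sum_distrib_right[symmetric])
qed simp

lemma mass_subcube:
  assumes "J \<subseteq> {..<n}" "\<And>j. j \<in> J \<Longrightarrow> v j = 1 \<or> v j = -1"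
  shows "mass n (subcube J v) = 2 ^ (n - card J)"
proof -
  have J: "{..<n} \<inter> J = J" "card ({..<n} - J) = n - card J"
    using assms(1) by (auto simp: card_Diff_subset finite_subset)
  have "mass n (subcube J v) = (\<Sum>x\<in>cube n. \<Prod>i<n. if i \<in> J then of_bool (x ! i = v i) else 1)"
    unfolding mass_def subcube_def by (simp add: prod.inter_restrict[symmetric] J)
  also have "\<dots> = (\<Prod>i<n. (if i \<in> J then of_bool (1 = v i) else 1) + (if i \<in> J then of_bool (-1 = v i) else 1))"
    by (rule sum_cube_prod[where \<phi> = "\<lambda>i a. if i \<in> J then of_bool (a = v i) else 1"])
  also have "\<dots> = (\<Prod>i<n. if i \<in> J then 1 else 2)"
    by (rule prod.cong) (use assms(2) in fastforce)+
  also have "\<dots> = 2 ^ (n - card J)"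
    by (simp add: prod.If_cases J Diff_eq[symmetric])
  finally show ?thesis .
qed

lemma flip_cube: "x \<in> cube n \<Longrightarrow> k < n \<Longrightarrow> x[k := - (x ! k)] \<in> cube n"
  using cube_nth[of x n k] set_update_subset_insert[of x k "- (x ! k)"]
  by (auto simp: cube_def)

lemma subcube_flip:
  assumes "k \<notin> J"
  shows "subcube J v (x[k := a]) = subcube J v x"
proof -
  have "k \<noteq> j" if "j \<in> J" for j using assms that by auto
  then show ?thesis unfolding subcube_def by (intro prod.cong refl) simp
qed

text \<open>Flipping the free coordinate \<open>k\<close> is an involution that preserves the
  subcube and exchanges the two extensions of the prefix.\<close>

lemma prefix_mass_subcube_flip:
  assumes "k < n" "k \<notin> J" "\<kappa> \<in> cube k"
  shows "prefix_mass n (subcube J v) (\<kappa> @ [1]) = prefix_mass n (subcube J v) (\<kappa> @ [-1])"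
  unfolding prefix_mass_def
proof (rule sum.reindex_bij_witness[where i = "\<lambda>x. x[k := - (x ! k)]" and j = "\<lambda>x. x[k := - (x ! k)]"])
  have len: "length \<kappa> = k" using assms(3) by (rule cube_length)
  have invol: "x[k := - (x ! k), k := - (x[k := - (x ! k)] ! k)] = x" if "x \<in> cube n" for x
    using cube_length[OF that] assms(1) by simp
  have *: "x[k := - (x ! k)] \<in> {x \<in> cube n. take (length (\<kappa> @ [- s])) x = \<kappa> @ [- s]}"
    if "x \<in> {x \<in> cube n. take (length (\<kappa> @ [s])) x = \<kappa> @ [s]}" for x s
  proof -
    have x: "x \<in> cube n" "length x = n" "take (Suc k) x = \<kappa> @ [s]" using that len by (auto simp: cube_length)
    then have "take k x = \<kappa>" "x ! k = s" using assms(1) len by (auto simp: take_Suc_conv_app_nth)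
    then show ?thesis using x flip_cube[OF x(1) assms(1)] assms(1) len
      by (simp add: take_Suc_conv_app_nth)
  qed
  show "x[k := - (x ! k)] \<in> {x \<in> cube n. take (length (\<kappa> @ [- 1])) x = \<kappa> @ [- 1]}"
    if "x \<in> {x \<in> cube n. take (length (\<kappa> @ [1])) x = \<kappa> @ [1]}" for x
    using *[OF that] .
  show "x[k := - (x ! k)] \<in> {x \<in> cube n. take (length (\<kappa> @ [1])) x = \<kappa> @ [1]}"
    if "x \<in> {x \<in> cube n. take (length (\<kappa> @ [- 1])) x = \<kappa> @ [- 1]}" for x
    using *[OF that] by simp
  show "x[k := - (x ! k), k := - (x[k := - (x ! k)] ! k)] = x"
    if "x \<in> {x \<in> cube n. take (length (\<kappa> @ [1])) x = \<kappa> @ [1]}" for x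
    by (rule invol) (use that in simp)
  show "x[k := - (x ! k), k := - (x[k := - (x ! k)] ! k)] = x"
    if "x \<in> {x \<in> cube n. take (length (\<kappa> @ [- 1])) x = \<kappa> @ [- 1]}" for x
    by (rule invol) (use that in simp)
  show "subcube J v (x[k := - (x ! k)]) = subcube J v x" for x
    by (rule subcube_flip[OF assms(2)])
qed

text \<open>A free coordinate is unbiased given any prefix, and
  \<open>bit_var p p = 2 * p\<close>.\<close>

lemma cond_var_subcube:
  assumes "k < n" "k \<notin> J"
  shows "cond_var n (subcube J v) k = mass n (subcube J v)"
  unfolding cond_var_def mass_by_coord[OF assms(1)]
  by (rule sum.cong) (auto simp: prefix_mass_subcube_flip[OF assms] bit_var_def)

text \<open>The conditional mean of a free coordinate is 0, so the later of the two coordinates is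
  its own innovation.\<close>

lemma subcube_orth:
  assumes "k < n" "k \<notin> J" "i < n" "i \<notin> J" "i \<noteq> k"
  shows "(\<Sum>x\<in>cube n. subcube J v x * (real_of_int (x ! i) * real_of_int (x ! k))) = 0"
proof -
  have lt: "(\<Sum>x\<in>cube n. subcube J v x * (real_of_int (x ! i) * real_of_int (x ! k))) = 0"
    if "k < n" "k \<notin> J" "i < k" for i k
  proof -
    have "innov n (subcube J v) k x = real_of_int (x ! k)" if "x \<in> cube n" for x
      using prefix_mass_subcube_flip[OF \<open>k < n\<close> \<open>k \<notin> J\<close> take_cube[OF that]] \<open>k < n\<close>
      by (simp add: innov_def cond_mean_def)
    then show ?thesis
      using earlier_coord_innov[of k n i "subcube J v", OF that(1,3) subcube_nonneg] by simp
  qed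
  show ?thesis using lt[of k i] lt[of i k] assms by (cases "i < k") (auto simp: mult.commute)
qed

lemma cube_nth_sq: "x \<in> cube n \<Longrightarrow> i < n \<Longrightarrow> real_of_int (x ! i) * real_of_int (x ! i) = 1"
  using cube_nth[of x n i] by auto

text \<open>The free coordinate products are orthonormal up to the masses, so second moment and
  potential both equal \<open>card T\<close> times the product of the masses.\<close>

lemma deficit_subcube:
  assumes T: "T \<subseteq> {..<n}" and J: "\<And>i. i \<in> T \<Longrightarrow> i \<notin> J" and J': "\<And>i. i \<in> T \<Longrightarrow> n - 1 - i \<notin> J'"
  shows "deficit n T (subcube J v) (subcube J' v') = 0"
proof -
  have fin: "finite T" using T finite_subset by blast
  have lt: "i < n" "n - 1 - i < n" if "i \<in> T" for i using T that by auto
  have sq: "(\<Sum>x\<in>cube n. f x * (real_of_int (x ! i) * real_of_int (x ! i))) = mass n f" if "i < n" for f i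
    unfolding mass_def by (rule sum.cong) (auto simp: cube_nth_sq[OF _ that])
  let ?f = "subcube J v" and ?g = "subcube J' v'"
  have "pair_sum n ?f ?g (\<lambda>x y. (restr_ip n T x y)\<^sup>2)
      = (\<Sum>k\<in>T. \<Sum>i\<in>T. (\<Sum>x\<in>cube n. ?f x * (real_of_int (x ! k) * real_of_int (x ! i)))
        * (\<Sum>y\<in>cube n. ?g y * (real_of_int (y ! (n - 1 - k)) * real_of_int (y ! (n - 1 - i)))))"
    unfolding restr_ip_def power2_eq_square by (rule pair_sum_bilinear)
  also have "\<dots> = (\<Sum>k\<in>T. (\<Sum>x\<in>cube n. ?f x * (real_of_int (x ! k) * real_of_int (x ! k)))
        * (\<Sum>y\<in>cube n. ?g y * (real_of_int (y ! (n - 1 - k)) * real_of_int (y ! (n - 1 - k)))))"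
    by (rule sum_sum_diag[OF fin]) (simp add: subcube_orth lt J)
  also have "\<dots> = (\<Sum>i\<in>T. cond_var n ?f i * cond_var n ?g (n - 1 - i))"
    by (rule sum.cong[OF refl]) (simp only: sq lt J J' cond_var_subcube not_False_eq_True)
  finally show ?thesis by (simp add: deficit_def)
qed

section \<open>Correlation under restrictions\<close>

lemma rev_cube: "rev y \<in> cube n \<longleftrightarrow> y \<in> cube n"
  by (simp add: cube_def)

lemma sum_cube_rev: "(\<Sum>y\<in>cube n. F (rev y)) = (\<Sum>y\<in>cube n. F y)"
  by (rule sum.reindex_bij_witness[where i = rev and j = rev]) (auto simp: rev_cube)

text \<open>The initial deficit is 0, so only the term for the communication remains in
  \<open>protocol_correlation\<close>. Bob's fixed coordinates \<open>S\<close> become the reflected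
  set \<open>S'\<close>.\<close>

lemma protocol_correlation_subcube:
  assumes S: "S \<subseteq> {..<n}" and v: "\<And>j. j \<in> S \<Longrightarrow> v j = 1 \<or> v j = -1" "\<And>j. j \<in> S \<Longrightarrow> v' j = 1 \<or> v' j = -1"
    and P: "pm1_outputs P" "comm P \<le> d"
  shows "\<bar>\<Sum>x\<in>cube n. \<Sum>y\<in>cube n. subcube S v x * subcube S v' y
      * (real_of_int (run P x y) * (\<Sum>i\<in>{..<n} - S. real_of_int (x ! i) * real_of_int (y ! i)))\<bar>
    \<le> (2 ^ (n - card S))\<^sup>2 * sqrt (2 * real d)"
proof -
  define T where "T = {..<n} - S"
  define S' where "S' = (\<lambda>j. n - 1 - j) ` S"
  define f g where "f = subcube S v" and "g = subcube S' (\<lambda>j. v' (n - 1 - j))"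
  have inv: "n - 1 - (n - 1 - j) = j" if "j < n" for j using that by auto
  have inj: "inj_on (\<lambda>j. n - 1 - j) S"
    by (rule inj_on_inverseI[where g = "\<lambda>j. n - 1 - j"]) (use S inv in auto)
  have S': "S' \<subseteq> {..<n}" using S by (auto simp: S'_def)
  have card: "card S' = card S" unfolding S'_def by (rule card_image[OF inj])
  have v'': "v' (n - 1 - j) = 1 \<or> v' (n - 1 - j) = -1" if "j \<in> S'" for j
    using that v(2) S inv unfolding S'_def by fastforce
  define M :: real where "M = 2 ^ (n - card S)"
  have mf: "mass n f = M" unfolding f_def M_def by (rule mass_subcube[OF S v(1)])
  have mg: "mass n g = M" unfolding g_def M_def card[symmetric] by (rule mass_subcube[OF S' v''])
  have "n - 1 - i \<notin> S'" if "i \<in> T" for i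
  proof
    assume "n - 1 - i \<in> S'"
    then obtain j where j: "j \<in> S" "n - 1 - i = n - 1 - j" by (auto simp: S'_def)
    have "i < n" "j < n" using j S that by (auto simp: T_def)
    then have "i = j" using inv j(2) by metis
    then show False using j that by (simp add: T_def)
  qed
  then have def0: "deficit n T f g = 0"
    unfolding f_def g_def by (intro deficit_subcube) (auto simp: T_def)
  have g: "subcube S v' (rev y) = g y" if "y \<in> cube n" for y
  proof -
    have "g y = (\<Prod>j\<in>S. of_bool (y ! (n - 1 - j) = v' (n - 1 - (n - 1 - j))))"
      unfolding g_def subcube_def S'_def by (simp only: prod.reindex[OF inj] o_def)
    also have "\<dots> = subcube S v' (rev y)"
      unfolding subcube_def
      by (rule prod.cong[OF refl]) (use S that inv in \<open>auto simp: rev_nth cube_length subset_iff\<close>)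
    finally show ?thesis ..
  qed
  have ip: "(\<Sum>i\<in>T. real_of_int (x ! i) * real_of_int (rev y ! i)) = restr_ip n T x y" if "y \<in> cube n" for x y
    unfolding restr_ip_def by (rule sum.cong) (use that in \<open>auto simp: T_def rev_nth cube_length\<close>)
  have "(\<Sum>x\<in>cube n. \<Sum>y\<in>cube n. subcube S v x * subcube S v' y
      * (real_of_int (run P x y) * (\<Sum>i\<in>T. real_of_int (x ! i) * real_of_int (y ! i))))
    = (\<Sum>x\<in>cube n. \<Sum>y\<in>cube n. subcube S v x * subcube S v' (rev y)
      * (real_of_int (run P x (rev y)) * (\<Sum>i\<in>T. real_of_int (x ! i) * real_of_int (rev y ! i))))"
    by (rule sum.cong[OF refl], rule sum_cube_rev[symmetric])
  also have "\<dots> = pair_sum n f g (\<lambda>x y. real_of_int (run P x (rev y)) * restr_ip n T x y)"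
    unfolding pair_sum_def f_def by (intro sum.cong refl) (simp only: g ip)
  finally have "\<bar>\<Sum>x\<in>cube n. \<Sum>y\<in>cube n. subcube S v x * subcube S v' y
      * (real_of_int (run P x y) * (\<Sum>i\<in>T. real_of_int (x ! i) * real_of_int (y ! i)))\<bar>
      \<le> sqrt (mass n f * mass n g * (deficit n T f g + 2 * real d * (mass n f * mass n g)))"
    using protocol_correlation[of T n P d f g] P by (simp add: f_def g_def subcube_nonneg T_def)
  also have "\<dots> = sqrt ((M\<^sup>2)\<^sup>2 * (2 * real d))"
    unfolding mf mg def0 by (simp add: power2_eq_square ac_simps)
  also have "\<dots> = M\<^sup>2 * sqrt (2 * real d)"
    by (simp only: real_sqrt_mult real_sqrt_abs abs_power2)
  finally show ?thesis by (simp add: T_def M_def)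
qed

text \<open>Pairs with \<open>x ! j * y ! j = s\<close> on \<open>S\<close> do not form a rectangle,
  but they are a uniform mixture of products of subcubes: \<open>w\<close> must equal
  \<open>x\<close> on \<open>S\<close> and is arbitrary elsewhere, hence the power of 2.\<close>

lemma agreement_mixture:
  assumes S: "S \<subseteq> {..<n}" and x: "x \<in> cube n" and y: "y \<in> cube n" and s: "s = 1 \<or> s = (-1 :: int)"
  shows "(\<Sum>w\<in>cube n. subcube S (\<lambda>j. w ! j) x * subcube S (\<lambda>j. s * w ! j) y)
    = 2 ^ (n - card S) * (\<Prod>j\<in>S. of_bool (x ! j * y ! j = s))"
proof -
  have J: "{..<n} \<inter> S = S" "card ({..<n} - S) = n - card S"
    using S by (auto simp: card_Diff_subset finite_subset)
  define \<phi> :: "nat \<Rightarrow> int \<Rightarrow> real" where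
    "\<phi> j a = (if j \<in> S then of_bool (x ! j = a) * of_bool (y ! j = s * a) else 1)" for j a
  have "(\<Sum>w\<in>cube n. subcube S (\<lambda>j. w ! j) x * subcube S (\<lambda>j. s * w ! j) y)
      = (\<Sum>w\<in>cube n. \<Prod>j<n. \<phi> j (w ! j))"
    unfolding subcube_def \<phi>_def prod.distrib[symmetric]
    by (simp add: prod.inter_restrict[symmetric] J)
  also have "\<dots> = (\<Prod>j<n. \<phi> j 1 + \<phi> j (-1))"
    by (rule sum_cube_prod)
  also have "\<dots> = (\<Prod>j<n. if j \<in> S then of_bool (x ! j * y ! j = s) else 2)"
    unfolding \<phi>_def
    by (rule prod.cong[OF refl]) (use cube_nth[OF x] cube_nth[OF y] s in fastforce)
  also have "\<dots> = 2 ^ (n - card S) * (\<Prod>j\<in>S. of_bool (x ! j * y ! j = s))"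
    by (simp add: prod.If_cases J Diff_eq[symmetric])
  finally show ?thesis .
qed

text \<open>The bound for each product of subcubes is summed over the mixture of
  \<open>agreement_mixture\<close>.\<close>

lemma protocol_correlation_restricted:
  assumes S: "S \<subseteq> {..<n}" and s: "s = 1 \<or> s = (-1 :: int)"
    and P: "pm1_outputs P" "comm P \<le> d"
  shows "\<bar>\<Sum>x\<in>cube n. \<Sum>y\<in>cube n. (\<Prod>j\<in>S. of_bool (x ! j * y ! j = s))
      * (real_of_int (run P x y) * (\<Sum>i\<in>{..<n} - S. real_of_int (x ! i) * real_of_int (y ! i)))\<bar>
    \<le> 2 ^ n * 2 ^ (n - card S) * sqrt (2 * real d)"
proof -
  define K where "K x y = real_of_int (run P x y) * (\<Sum>i\<in>{..<n} - S. real_of_int (x ! i) * real_of_int (y ! i))" for x y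
  define M :: real where "M = 2 ^ (n - card S)"
  have M: "M > 0" by (simp add: M_def)
  have "M * (\<Sum>x\<in>cube n. \<Sum>y\<in>cube n. (\<Prod>j\<in>S. of_bool (x ! j * y ! j = s)) * K x y)
      = (\<Sum>x\<in>cube n. \<Sum>y\<in>cube n. \<Sum>w\<in>cube n. subcube S (\<lambda>j. w ! j) x * subcube S (\<lambda>j. s * w ! j) y * K x y)"
    unfolding sum_distrib_left
    by (intro sum.cong refl)
      (simp add: sum_distrib_right[symmetric] agreement_mixture[OF S _ _ s] M_def)
  also have "\<dots> = (\<Sum>w\<in>cube n. \<Sum>x\<in>cube n. \<Sum>y\<in>cube n. subcube S (\<lambda>j. w ! j) x * subcube S (\<lambda>j. s * w ! j) y * K x y)"
    by (subst sum.swap[of _ "cube n" "cube n"], subst (2) sum.swap) (rule refl)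
  also have "\<bar>\<dots>\<bar> \<le> (\<Sum>w\<in>cube n. M\<^sup>2 * sqrt (2 * real d))"
  proof (rule order_trans[OF sum_abs sum_mono])
    fix w assume w: "w \<in> cube n"
    have wj: "w ! j = 1 \<or> w ! j = -1" if "j \<in> S" for j using cube_nth[OF w] S that by auto
    then have swj: "s * w ! j = 1 \<or> s * w ! j = -1" if "j \<in> S" for j using s that by fastforce
    show "\<bar>\<Sum>x\<in>cube n. \<Sum>y\<in>cube n. subcube S (\<lambda>j. w ! j) x * subcube S (\<lambda>j. s * w ! j) y * K x y\<bar>
        \<le> M\<^sup>2 * sqrt (2 * real d)"
      unfolding K_def M_def by (rule protocol_correlation_subcube[OF S wj swj P])
  qed
  \<comment> \<open>One factor \<open>M\<close> is set aside to cancel the multiplicity in the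
    mixture.\<close>
  also have "\<dots> = M * (2 ^ n * M * sqrt (2 * real d))"
    by (simp add: card_cube power2_eq_square)
  finally have "M * \<bar>\<Sum>x\<in>cube n. \<Sum>y\<in>cube n. (\<Prod>j\<in>S. of_bool (x ! j * y ! j = s)) * K x y\<bar>
      \<le> M * (2 ^ n * M * sqrt (2 * real d))"
    using M by (simp add: abs_mult)
  then show ?thesis using M unfolding K_def M_def by (simp only: mult_le_cancel_left_pos)
qed

section \<open>Fiber expectation as a sum over input pairs\<close>

lemma odot_nth: "length x = n \<Longrightarrow> length y = n \<Longrightarrow> i < n \<Longrightarrow> odot x y ! i = x ! i * y ! i"
  by (simp add: odot_def)

lemma length_odot: "length x = n \<Longrightarrow> length y = n \<Longrightarrow> length (odot x y) = n"
  by (simp add: odot_def)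

lemma cube_iff: "x \<in> cube n \<longleftrightarrow> length x = n \<and> (\<forall>i<n. x ! i = 1 \<or> x ! i = -1)"
  unfolding cube_def by (auto simp: subset_iff in_set_conv_nth)

lemma odot_cube:
  assumes "x \<in> cube n" "y \<in> cube n"
  shows "odot x y \<in> cube n"
  unfolding cube_iff
proof safe
  show "length (odot x y) = n" using assms by (simp add: length_odot cube_length)
  fix i assume "i < n" "odot x y ! i \<noteq> -1"
  then show "odot x y ! i = 1"
    using assms cube_nth[OF assms(1), of i] cube_nth[OF assms(2), of i] by (auto simp: odot_nth cube_length)
qed

lemma odot_odot:
  assumes "x \<in> cube n" "y \<in> cube n"
  shows "odot x (odot x y) = y"
proof (rule nth_equalityI)
  show "length (odot x (odot x y)) = length y"
    using assms by (simp add: odot_def cube_length)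
  fix i assume "i < length (odot x (odot x y))"
  then have "i < n" using assms by (simp add: odot_def cube_length)
  then show "odot x (odot x y) ! i = y ! i"
    using assms cube_nth[OF assms(1), of i] by (auto simp: odot_nth length_odot cube_length)
qed

text \<open>The first input is free and determines the second, because \<open>odot x\<close> is an
  involution.\<close>

lemma card_fiber:
  assumes "z \<in> cube n"
  shows "card {(x,y). x \<in> cube n \<and> y \<in> cube n \<and> odot x y = z} = 2 ^ n"
proof -
  have "{(x,y). x \<in> cube n \<and> y \<in> cube n \<and> odot x y = z} = (\<lambda>x. (x, odot x z)) ` cube n"
    using assms odot_cube odot_odot by (auto simp: image_iff)
  moreover have "card ((\<lambda>x. (x, odot x z)) ` cube n) = card (cube n)"
    by (rule card_image) (auto simp: inj_on_def)
  ultimately show ?thesis by (simp add: card_cube)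
qed

lemma nu_odot:
  assumes "x \<in> cube n" "y \<in> cube n"
  shows "nu \<rho> (odot x y) = (\<Prod>i<n. (1 + \<rho> * real_of_int (x ! i * y ! i)) / 2)"
  using assms by (simp add: nu_def length_odot odot_nth cube_length)

text \<open>All fibers have size \<open>2 ^ n\<close>, so regrouping by fiber yields a sum over all
  input pairs, an explicit polynomial in \<open>\<rho>\<close>.\<close>

lemma expect_xor_fiber:
  "expect_nu n \<rho> (xor_fiber n C) = (\<Sum>x\<in>cube n. \<Sum>y\<in>cube n.
     (\<Prod>i<n. (1 + \<rho> * real_of_int (x ! i * y ! i)) / 2) * real_of_int (C x y)) / 2 ^ n"
proof -
  have "expect_nu n \<rho> (xor_fiber n C) = (\<Sum>z\<in>cube n. \<Sum>p\<in>{p \<in> cube n \<times> cube n. (case p of (x, y) \<Rightarrow> odot x y) = z}.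
      case p of (x, y) \<Rightarrow> nu \<rho> (odot x y) * real_of_int (C x y) / 2 ^ n)"
    unfolding expect_nu_def
  proof (rule sum.cong[OF refl])
    fix z assume z: "z \<in> cube n"
    have eq: "{(x,y). x \<in> cube n \<and> y \<in> cube n \<and> odot x y = z}
        = {p \<in> cube n \<times> cube n. (case p of (x, y) \<Rightarrow> odot x y) = z}" by auto
    show "nu \<rho> z * xor_fiber n C z = (\<Sum>p\<in>{p \<in> cube n \<times> cube n. (case p of (x, y) \<Rightarrow> odot x y) = z}.
      case p of (x, y) \<Rightarrow> nu \<rho> (odot x y) * real_of_int (C x y) / 2 ^ n)"
      unfolding xor_fiber_def card_fiber[OF z] unfolding eq
      by (simp add: sum_distrib_left sum_divide_distrib) (rule sum.cong, auto)
  qed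
  also have "\<dots> = (\<Sum>p\<in>cube n \<times> cube n. case p of (x, y) \<Rightarrow> nu \<rho> (odot x y) * real_of_int (C x y) / 2 ^ n)"
    by (rule sum.group) (auto simp: odot_cube)
  also have "\<dots> = (\<Sum>x\<in>cube n. \<Sum>y\<in>cube n. nu \<rho> (odot x y) * real_of_int (C x y)) / 2 ^ n"
    by (simp add: sum.cartesian_product sum_divide_distrib case_prod_beta)
  also have "(\<Sum>x\<in>cube n. \<Sum>y\<in>cube n. nu \<rho> (odot x y) * real_of_int (C x y))
      = (\<Sum>x\<in>cube n. \<Sum>y\<in>cube n. (\<Prod>i<n. (1 + \<rho> * real_of_int (x ! i * y ! i)) / 2) * real_of_int (C x y))"
    by (intro sum.cong refl) (simp only: nu_odot)
  finally show ?thesis .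
qed

section \<open>Derivative in the bias as a random restriction\<close>

text \<open>\<open>S\<close> collects the factors from which \<open>\<alpha>\<close> is chosen. The
  extra \<open>\<beta>\<close> stands for the removed factor \<open>i\<close>, so \<open>i\<close>
  always counts among the free indices \<open>A - S\<close>.\<close>

lemma sum_prod_remove_expand:
  fixes c \<alpha> :: "'a \<Rightarrow> real"
  assumes "finite A"
  shows "\<beta> * (\<Sum>i\<in>A. c i * (\<Prod>j\<in>A - {i}. \<alpha> j + \<beta>))
    = (\<Sum>S\<in>Pow A. (\<Prod>j\<in>S. \<alpha> j) * \<beta> ^ card (A - S) * (\<Sum>i\<in>A - S. c i))"
proof -
  have one: "\<beta> * (\<Prod>j\<in>A - {i}. \<alpha> j + \<beta>)
      = (\<Sum>S\<in>Pow A. if i \<in> A - S then (\<Prod>j\<in>S. \<alpha> j) * \<beta> ^ card (A - S) else 0)" if "i \<in> A" for i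
  proof -
    \<comment> \<open>With \<open>\<alpha>\<close> set to 0 at \<open>i\<close>, the
      \<open>i\<close>-th factor is \<open>\<beta>\<close> and every \<open>S\<close> containing
      \<open>i\<close> drops out of the expansion.\<close>
    define \<alpha>' where "\<alpha>' j = (if j = i then 0 else \<alpha> j)" for j
    have "(\<Prod>j\<in>A. \<alpha>' j + \<beta>) = (\<alpha>' i + \<beta>) * (\<Prod>j\<in>A - {i}. \<alpha>' j + \<beta>)"
      by (rule prod.remove[OF assms that])
    also have "(\<Prod>j\<in>A - {i}. \<alpha>' j + \<beta>) = (\<Prod>j\<in>A - {i}. \<alpha> j + \<beta>)"
      by (rule prod.cong) (auto simp: \<alpha>'_def)
    finally have "\<beta> * (\<Prod>j\<in>A - {i}. \<alpha> j + \<beta>) = (\<Prod>j\<in>A. \<alpha>' j + \<beta>)"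
      by (simp add: \<alpha>'_def)
    also have "\<dots> = (\<Sum>S\<in>Pow A. (\<Prod>j\<in>S. \<alpha>' j) * \<beta> ^ card (A - S))"
      using assms by (simp add: prod_add)
    also have "\<dots> = (\<Sum>S\<in>Pow A. if i \<in> A - S then (\<Prod>j\<in>S. \<alpha> j) * \<beta> ^ card (A - S) else 0)"
    proof (rule sum.cong[OF refl])
      fix S assume "S \<in> Pow A"
      then have fin: "finite S" using assms finite_subset by auto
      have "(\<Prod>j\<in>S. \<alpha>' j) = (if i \<in> S then 0 else \<Prod>j\<in>S. \<alpha> j)"
        using fin by (auto simp: \<alpha>'_def prod_zero_iff intro!: prod.cong)
      then show "(\<Prod>j\<in>S. \<alpha>' j) * \<beta> ^ card (A - S)
          = (if i \<in> A - S then (\<Prod>j\<in>S. \<alpha> j) * \<beta> ^ card (A - S) else 0)"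
        using that by auto
    qed
    finally show ?thesis .
  qed
  have "\<beta> * (\<Sum>i\<in>A. c i * (\<Prod>j\<in>A - {i}. \<alpha> j + \<beta>))
      = (\<Sum>i\<in>A. c i * (\<beta> * (\<Prod>j\<in>A - {i}. \<alpha> j + \<beta>)))"
    by (simp add: sum_distrib_left mult.left_commute)
  also have "\<dots> = (\<Sum>i\<in>A. \<Sum>S\<in>Pow A. c i * (if i \<in> A - S then (\<Prod>j\<in>S. \<alpha> j) * \<beta> ^ card (A - S) else 0))"
    by (intro sum.cong refl) (simp only: one sum_distrib_left)
  also have "\<dots> = (\<Sum>S\<in>Pow A. \<Sum>i\<in>A. c i * (if i \<in> A - S then (\<Prod>j\<in>S. \<alpha> j) * \<beta> ^ card (A - S) else 0))"
    by (rule sum.swap)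
  also have "\<dots> = (\<Sum>S\<in>Pow A. (\<Prod>j\<in>S. \<alpha> j) * \<beta> ^ card (A - S) * (\<Sum>i\<in>A - S. c i))"
  proof (rule sum.cong[OF refl])
    fix S
    define B where "B = (\<Prod>j\<in>S. \<alpha> j) * \<beta> ^ card (A - S)"
    have "(\<Sum>i\<in>A. c i * (if i \<in> A - S then B else 0)) = (\<Sum>i\<in>A - S. c i * B)"
      using assms by (intro sum.mono_neutral_cong_right) auto
    then show "(\<Sum>i\<in>A. c i * (if i \<in> A - S then (\<Prod>j\<in>S. \<alpha> j) * \<beta> ^ card (A - S) else 0))
        = (\<Prod>j\<in>S. \<alpha> j) * \<beta> ^ card (A - S) * (\<Sum>i\<in>A - S. c i)"
      unfolding B_def by (simp only: sum_distrib_right[symmetric] mult.commute)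
  qed
  finally show ?thesis .
qed

definition expect_deriv :: "nat \<Rightarrow> proto \<Rightarrow> real \<Rightarrow> real" where
  "expect_deriv n P \<rho> = (\<Sum>x\<in>cube n. \<Sum>y\<in>cube n.
     (\<Sum>i<n. real_of_int (x ! i * y ! i) / 2 * (\<Prod>j\<in>{..<n} - {i}. (1 + \<rho> * real_of_int (x ! j * y ! j)) / 2))
       * real_of_int (run P x y)) / 2 ^ n"

lemma expect_xor_fiber_deriv:
  "((\<lambda>\<rho>. expect_nu n \<rho> (xor_fiber n (run P))) has_real_derivative expect_deriv n P \<rho>) (at \<rho>)"
  unfolding expect_xor_fiber expect_deriv_def
  by (intro DERIV_cdivide DERIV_sum DERIV_cmult_right has_field_derivative_prod)
    (auto intro!: derivative_eq_intros)

text \<open>Multiplied by \<open>\<beta>\<close>, the derivative is an average over restrictions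
  \<open>S\<close> of correlations with the inner product of the free coordinates, each bounded by
  \<open>protocol_correlation_restricted\<close>.\<close>

lemma expect_deriv_bound:
  assumes P: "pm1_outputs P" "comm P \<le> d" and \<rho>: "\<bar>\<rho>\<bar> < 1"
  shows "\<bar>expect_deriv n P \<rho>\<bar> \<le> sqrt (2 * real d) / (1 - \<bar>\<rho>\<bar>)"
proof -
  \<comment> \<open>Each factor of the measure is a mixture: the coordinate product is fixed to
    \<open>s\<close> with probability \<open>r\<close> and uniform with probability
    \<open>2 * \<beta>\<close>.\<close>
  define r \<beta> where "r = \<bar>\<rho>\<bar>" and "\<beta> = (1 - r) / 2"
  define s :: int where "s = (if \<rho> \<ge> 0 then 1 else -1)"
  have s: "s = 1 \<or> s = -1" by (simp add: s_def)
  have r0: "r \<ge> 0" and b0: "\<beta> > 0" using \<rho> by (auto simp: r_def \<beta>_def)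
  define K where "K S = (\<Sum>x\<in>cube n. \<Sum>y\<in>cube n. (\<Prod>j\<in>S. of_bool (x ! j * y ! j = s))
      * (real_of_int (run P x y) * (\<Sum>i\<in>{..<n} - S. real_of_int (x ! i) * real_of_int (y ! i))))" for S
  have mix: "(1 + \<rho> * real_of_int (x ! j * y ! j)) / 2 = r * of_bool (x ! j * y ! j = s) + \<beta>"
    if "x \<in> cube n" "y \<in> cube n" "j < n" for x y j
    using cube_nth[OF that(1,3)] cube_nth[OF that(2,3)]
    by (auto simp: r_def \<beta>_def s_def field_simps)
  have inner: "\<beta> * (\<Sum>i<n. real_of_int (x ! i * y ! i) / 2
        * (\<Prod>j\<in>{..<n} - {i}. (1 + \<rho> * real_of_int (x ! j * y ! j)) / 2))
      = (\<Sum>S\<in>Pow {..<n}. r ^ card S * \<beta> ^ (n - card S) / 2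
        * ((\<Prod>j\<in>S. of_bool (x ! j * y ! j = s)) * (\<Sum>i\<in>{..<n} - S. real_of_int (x ! i) * real_of_int (y ! i))))"
    if xy: "x \<in> cube n" "y \<in> cube n" for x y
  proof -
    have "\<beta> * (\<Sum>i<n. real_of_int (x ! i * y ! i) / 2
        * (\<Prod>j\<in>{..<n} - {i}. (1 + \<rho> * real_of_int (x ! j * y ! j)) / 2))
      = \<beta> * (\<Sum>i<n. real_of_int (x ! i * y ! i) / 2
        * (\<Prod>j\<in>{..<n} - {i}. r * of_bool (x ! j * y ! j = s) + \<beta>))"
      by (intro arg_cong2[where f = "(*)"] sum.cong prod.cong refl mix xy) auto
    also have "\<dots> = (\<Sum>S\<in>Pow {..<n}. (\<Prod>j\<in>S. r * of_bool (x ! j * y ! j = s)) * \<beta> ^ card ({..<n} - S)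
        * (\<Sum>i\<in>{..<n} - S. real_of_int (x ! i * y ! i) / 2))"
      by (rule sum_prod_remove_expand) simp
    also have "\<dots> = (\<Sum>S\<in>Pow {..<n}. r ^ card S * \<beta> ^ (n - card S) / 2
        * ((\<Prod>j\<in>S. of_bool (x ! j * y ! j = s)) * (\<Sum>i\<in>{..<n} - S. real_of_int (x ! i) * real_of_int (y ! i))))"
    proof (rule sum.cong[OF refl])
      fix S assume "S \<in> Pow {..<n}"
      then have "card ({..<n} - S) = n - card S" by (auto simp: card_Diff_subset finite_subset)
      moreover have "(\<Sum>i\<in>{..<n} - S. real_of_int (x ! i * y ! i) / 2)
          = (\<Sum>i\<in>{..<n} - S. real_of_int (x ! i) * real_of_int (y ! i)) / 2"
        by (simp add: sum_divide_distrib)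
      ultimately show "(\<Prod>j\<in>S. r * of_bool (x ! j * y ! j = s)) * \<beta> ^ card ({..<n} - S)
          * (\<Sum>i\<in>{..<n} - S. real_of_int (x ! i * y ! i) / 2)
        = r ^ card S * \<beta> ^ (n - card S) / 2
        * ((\<Prod>j\<in>S. of_bool (x ! j * y ! j = s)) * (\<Sum>i\<in>{..<n} - S. real_of_int (x ! i) * real_of_int (y ! i)))"
        by (simp add: prod.distrib)
    qed
    finally show ?thesis .
  qed
  have scale: "2 ^ n * (\<beta> * ((\<Sum>x\<in>cube n. \<Sum>y\<in>cube n. I x y * J x y) / 2 ^ n))
      = (\<Sum>x\<in>cube n. \<Sum>y\<in>cube n. \<beta> * I x y * J x y)" for I J :: "int list \<Rightarrow> int list \<Rightarrow> real"
  proof -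
    have "2 ^ n * (\<beta> * ((\<Sum>x\<in>cube n. \<Sum>y\<in>cube n. I x y * J x y) / 2 ^ n))
        = \<beta> * (\<Sum>x\<in>cube n. \<Sum>y\<in>cube n. I x y * J x y)" by simp
    then show ?thesis by (simp only: sum_distrib_left mult.assoc)
  qed
  have "2 ^ n * (\<beta> * expect_deriv n P \<rho>)
      = (\<Sum>x\<in>cube n. \<Sum>y\<in>cube n. \<beta> * (\<Sum>i<n. real_of_int (x ! i * y ! i) / 2
          * (\<Prod>j\<in>{..<n} - {i}. (1 + \<rho> * real_of_int (x ! j * y ! j)) / 2)) * real_of_int (run P x y))"
    unfolding expect_deriv_def by (rule scale)
  also have "\<dots> = (\<Sum>x\<in>cube n. \<Sum>y\<in>cube n. \<Sum>S\<in>Pow {..<n}. r ^ card S * \<beta> ^ (n - card S) / 2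
      * ((\<Prod>j\<in>S. of_bool (x ! j * y ! j = s))
        * (real_of_int (run P x y) * (\<Sum>i\<in>{..<n} - S. real_of_int (x ! i) * real_of_int (y ! i)))))"
    by (intro sum.cong refl, simp only: inner sum_distrib_right, intro sum.cong refl) (simp only: ac_simps)
  also have "\<dots> = (\<Sum>S\<in>Pow {..<n}. r ^ card S * \<beta> ^ (n - card S) / 2 * K S)"
    unfolding K_def sum_distrib_left
    by (subst (2) sum.swap, subst sum.swap) (rule refl)
  also have "\<bar>\<dots>\<bar> \<le> (\<Sum>S\<in>Pow {..<n}. r ^ card S * \<beta> ^ (n - card S) / 2
      * (2 ^ n * 2 ^ (n - card S) * sqrt (2 * real d)))"
  proof (rule order_trans[OF sum_abs sum_mono])
    fix S assume "S \<in> Pow {..<n}"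
    then have "\<bar>K S\<bar> \<le> 2 ^ n * 2 ^ (n - card S) * sqrt (2 * real d)"
      unfolding K_def by (intro protocol_correlation_restricted s P) auto
    then show "\<bar>r ^ card S * \<beta> ^ (n - card S) / 2 * K S\<bar>
        \<le> r ^ card S * \<beta> ^ (n - card S) / 2 * (2 ^ n * 2 ^ (n - card S) * sqrt (2 * real d))"
      unfolding abs_mult using r0 b0 by (simp add: mult_left_mono)
  qed
  \<comment> \<open>The count of free inputs turns each \<open>\<beta>\<close> into
    \<open>2 * \<beta>\<close>; the weights of the restrictions then sum to
    \<open>(r + 2 * \<beta>) ^ n = 1\<close>.\<close>
  also have "\<dots> = 2 ^ n * (sqrt (2 * real d) / 2) * (\<Sum>S\<in>Pow {..<n}. (\<Prod>j\<in>S. r) * (\<Prod>j\<in>{..<n} - S. 2 * \<beta>))"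
    unfolding sum_distrib_left
  proof (rule sum.cong[OF refl])
    fix S assume "S \<in> Pow {..<n}"
    then have "card ({..<n} - S) = n - card S" by (auto simp: card_Diff_subset finite_subset)
    then show "r ^ card S * \<beta> ^ (n - card S) / 2 * (2 ^ n * 2 ^ (n - card S) * sqrt (2 * real d))
      = 2 ^ n * (sqrt (2 * real d) / 2) * ((\<Prod>j\<in>S. r) * (\<Prod>j\<in>{..<n} - S. 2 * \<beta>))"
      by (simp add: power_mult_distrib)
  qed
  also have "(\<Sum>S\<in>Pow {..<n}. (\<Prod>j\<in>S. r) * (\<Prod>j\<in>{..<n} - S. 2 * \<beta>)) = (\<Prod>j<n. r + 2 * \<beta>)"
    by (rule prod_add[symmetric]) simp
  also have "r + 2 * \<beta> = 1" by (simp add: \<beta>_def field_simps)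
  finally have "2 ^ n * \<bar>\<beta> * expect_deriv n P \<rho>\<bar> \<le> 2 ^ n * (sqrt (2 * real d) / 2)"
    by (simp add: abs_mult)
  then have "\<bar>\<beta> * expect_deriv n P \<rho>\<bar> \<le> sqrt (2 * real d) / 2" by simp
  then have "(1 - r) * \<bar>expect_deriv n P \<rho>\<bar> \<le> sqrt (2 * real d)"
    using b0 by (simp add: abs_mult \<beta>_def)
  then show ?thesis using \<rho> by (simp add: r_def pos_le_divide_eq mult.commute)
qed

section \<open>Trivial bound and mean value argument\<close>

lemma run_bounded: "pm1_outputs P \<Longrightarrow> \<bar>real_of_int (run P x y)\<bar> \<le> 1"
  by (induction P) auto

text \<open>An average of values in [-1, 1] under a probability measure. It serves for large
  \<open>\<rho>\<close>, where the derivative bound blows up.\<close>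

lemma expect_xor_fiber_bounded:
  assumes "pm1_outputs P" "\<bar>\<rho>\<bar> \<le> 1"
  shows "\<bar>expect_nu n \<rho> (xor_fiber n (run P))\<bar> \<le> 1"
proof -
  have nu0: "nu \<rho> z \<ge> 0" if "z \<in> cube n" for z
    unfolding nu_def using assms(2) cube_nth[OF that] cube_length[OF that]
    by (intro prod_nonneg ballI) (fastforce simp: abs_le_iff)
  have fiber: "\<bar>xor_fiber n (run P) z\<bar> \<le> 1" if "z \<in> cube n" for z
  proof -
    have "\<bar>\<Sum>(x,y)\<in>{(x,y). x \<in> cube n \<and> y \<in> cube n \<and> odot x y = z}. real_of_int (run P x y)\<bar>
        \<le> (\<Sum>p\<in>{(x,y). x \<in> cube n \<and> y \<in> cube n \<and> odot x y = z}. 1)"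
      by (rule order_trans[OF sum_abs sum_mono]) (use run_bounded[OF assms(1)] in auto)
    then show ?thesis by (simp add: xor_fiber_def card_fiber[OF that] abs_divide)
  qed
  have "\<bar>expect_nu n \<rho> (xor_fiber n (run P))\<bar> \<le> (\<Sum>z\<in>cube n. nu \<rho> z)"
    unfolding expect_nu_def
    by (rule order_trans[OF sum_abs sum_mono])
      (simp add: abs_mult nu0 mult_left_le fiber)
  also have "\<dots> = (\<Sum>z\<in>cube n. \<Prod>i<n. (1 + \<rho> * real_of_int (z ! i)) / 2)"
    by (rule sum.cong) (auto simp: nu_def cube_length)
  also have "\<dots> = 1"
    using sum_cube_prod[of "\<lambda>i a. (1 + \<rho> * real_of_int a) / 2" n] by (simp add: field_simps)
  finally show ?thesis .
qed

text \<open>\<open>MVT2\<close> needs an ordered interval, hence the two signs. The intermediate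
  point is strictly closer to 0 than \<open>\<rho>\<close>, so the derivative bound is available
  even for \<open>\<rho>\<close> equal to 1 or -1.\<close>

lemma expect_xor_fiber_mvt:
  assumes "\<rho> \<noteq> 0"
  shows "\<exists>z. \<bar>z\<bar> < \<bar>\<rho>\<bar> \<and>
    \<bar>expect_nu n \<rho> (xor_fiber n (run P)) - expect_nu n 0 (xor_fiber n (run P))\<bar>
      = \<bar>\<rho>\<bar> * \<bar>expect_deriv n P z\<bar>"
proof (cases "\<rho> > 0")
  case True
  from MVT2[OF True expect_xor_fiber_deriv, of n P]
  obtain z where "0 < z" "z < \<rho>" "expect_nu n \<rho> (xor_fiber n (run P)) - expect_nu n 0 (xor_fiber n (run P))
      = (\<rho> - 0) * expect_deriv n P z" by blast
  then show ?thesis by (intro exI[of _ z]) (simp add: abs_mult)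
next
  case False
  then have "\<rho> < 0" using assms by simp
  from MVT2[OF this expect_xor_fiber_deriv, of n P]
  obtain z where "\<rho> < z" "z < 0" "expect_nu n 0 (xor_fiber n (run P)) - expect_nu n \<rho> (xor_fiber n (run P))
      = (0 - \<rho>) * expect_deriv n P z" by blast
  then show ?thesis by (intro exI[of _ z]) (simp add: abs_mult abs_minus_commute)
qed

theorem theorem1p5:
  "\<exists>C::real. C > 0 \<and>
     (\<forall>(n::nat) (d::nat) (P::proto) (\<rho>::real).
        pm1_outputs P \<longrightarrow> comm P \<le> d \<longrightarrow> \<bar>\<rho>\<bar> \<le> 1 \<longrightarrow>
        \<bar>expect_nu n \<rho> (xor_fiber n (run P)) - expect_nu n 0 (xor_fiber n (run P))\<bar>
          \<le> C * \<bar>\<rho>\<bar> * sqrt (real d))"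
proof (rule exI[of _ 4], intro conjI allI impI)
  fix n d P and \<rho> :: real
  assume P: "pm1_outputs P" "comm P \<le> d" and \<rho>: "\<bar>\<rho>\<bar> \<le> 1"
  define \<Delta> where "\<Delta> = \<bar>expect_nu n \<rho> (xor_fiber n (run P)) - expect_nu n 0 (xor_fiber n (run P))\<bar>"
  have mvt: "\<exists>z. \<bar>z\<bar> < \<bar>\<rho>\<bar> \<and> \<Delta> \<le> \<bar>\<rho>\<bar> * (sqrt (2 * real d) / (1 - \<bar>z\<bar>))" if nz: "\<rho> \<noteq> 0"
  proof -
    obtain z where z: "\<bar>z\<bar> < \<bar>\<rho>\<bar>" "\<Delta> = \<bar>\<rho>\<bar> * \<bar>expect_deriv n P z\<bar>"
      using expect_xor_fiber_mvt[OF nz] unfolding \<Delta>_def by blast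
    moreover have "\<bar>expect_deriv n P z\<bar> \<le> sqrt (2 * real d) / (1 - \<bar>z\<bar>)"
      using expect_deriv_bound[OF P, of z n] z(1) \<rho> by simp
    ultimately have "\<Delta> \<le> \<bar>\<rho>\<bar> * (sqrt (2 * real d) / (1 - \<bar>z\<bar>))"
      by (simp only: mult_left_mono abs_ge_zero)
    with z(1) show ?thesis by blast
  qed
  \<comment> \<open>For \<open>d = 0\<close> the derivative bound is 0. Otherwise 4 covers
    \<open>2 * sqrt 2\<close> from the derivative when \<open>\<rho>\<close> is at most 1/2 in
    absolute value, and beyond that \<open>4 * \<bar>\<rho>\<bar>\<close> exceeds the trivial bound
    2.\<close>
  consider "\<rho> = 0" | "d = 0" "\<rho> \<noteq> 0" | "\<rho> \<noteq> 0" "\<bar>\<rho>\<bar> \<le> 1 / 2" | "d \<ge> 1" "\<bar>\<rho>\<bar> > 1 / 2" by linarith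
  then have "\<Delta> \<le> 4 * \<bar>\<rho>\<bar> * sqrt (real d)"
  proof cases
    case 1
    then show ?thesis by (simp add: \<Delta>_def)
  next
    case 2
    then show ?thesis using mvt by auto
  next
    case 3
    then obtain z where z: "\<bar>z\<bar> < \<bar>\<rho>\<bar>" "\<Delta> \<le> \<bar>\<rho>\<bar> * (sqrt (2 * real d) / (1 - \<bar>z\<bar>))"
      using mvt by blast
    have "sqrt 2 \<le> 2" by (rule real_le_lsqrt) simp_all
    have "sqrt (2 * real d) / (1 - \<bar>z\<bar>) \<le> sqrt (2 * real d) / (1 / 2)"
      using z(1) 3 by (intro divide_left_mono) auto
    also have "\<dots> \<le> 4 * sqrt (real d)"
      using mult_right_mono[OF \<open>sqrt 2 \<le> 2\<close>, of "sqrt (real d)"] by (simp add: real_sqrt_mult mult.commute)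
    finally have "\<bar>\<rho>\<bar> * (sqrt (2 * real d) / (1 - \<bar>z\<bar>)) \<le> \<bar>\<rho>\<bar> * (4 * sqrt (real d))"
      by (rule mult_left_mono) simp
    with z(2) show ?thesis by simp
  next
    case 4
    have "\<Delta> \<le> 2"
      using expect_xor_fiber_bounded[OF P(1) \<rho>, of n] expect_xor_fiber_bounded[OF P(1), of 0 n]
      by (simp add: \<Delta>_def)
    also have "2 \<le> 4 * \<bar>\<rho>\<bar> * 1" using 4 by simp
    also have "\<dots> \<le> 4 * \<bar>\<rho>\<bar> * sqrt (real d)" using 4 by (intro mult_left_mono) auto
    finally show ?thesis .
  qed
  then show "\<bar>expect_nu n \<rho> (xor_fiber n (run P)) - expect_nu n 0 (xor_fiber n (run P))\<bar>
      \<le> 4 * \<bar>\<rho>\<bar> * sqrt (real d)" by (simp add: \<Delta>_def)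
qed simp

end
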